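(* Let $d\ge1$ and, for each $k\ge1$, let $I_k=\prod_{i=1}^d[0,b_i^{(k)}]\cap\mathbb{Z}^d$ be a rectangular prism with one corner at the origin, with positive integer dimensions $b_1^{(k)},\dots,b_d^{(k)}$ and diameter $\ell_k$, such that for some positive absolute constants $c,C'$ one has $c\le b_i^{(k)}/b_j^{(k)}\le C'$ for all $i,j,k$. Suppose $$\frac{\sum_{i=1}^k\ell_i}{\ell_{k+1}}\to0\quad\text{as }k\to\infty.$$ Let $\vec a_k=(a_k,a_k,\dots,a_k)\in\mathbb{Z}^d$, with $a_k\ge 0$ an integer, be vectors such that $|\vec a_{k+1}|>|\vec a_k|+\ell_k$ for all $k\geq 1$ and $\ell_k\ge C|\vec a_{k-1}|$ for all $k\ge2$, where $C>0$ is independent of $k$. Let $S=\bigcup_k(\vec a_k+I_k)$ and let $B_r$ be the ball of radius $r$ in $\mathbb{Z}^d$ centered at the origin. Then $\{S\cap B_r:r\ge1\}$ is a pointwise $L^1$-good sequence of sets for any aperiodic $\mathbb{Z}^d$ action; that is, for every aperiodic measure-preserving $\mathbb{Z}^d$-action $\mathcal{T}$ on a probability space $X$ and every $f\in L^1(X)$, the averages $$\frac1{\#(S\cap B_r)}\sum_{\vec n\in S\cap B_r}f(\mathcal{T}(\vec n)x)$$ converge for almost every $x\in X$ as $r\to\infty$.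
   Context: $|\cdot|$ is the Euclidean norm, and balls and diameters are Euclidean. A measure-preserving $\mathbb{Z}^d$-action satisfies $\mathcal{T}(\vec n)\mathcal{T}(\vec m)=\mathcal{T}(\vec n+\vec m)$. It is aperiodic (free) if for every $\vec n\ne\vec 0$ the set $\{x:\mathcal{T}(\vec n)x=x\}$ has measure $0$. The averages are considered for those $r$ with $S\cap B_r\ne\emptyset$. *)

theory Defs
  imports "HOL-Probability.Probability"
begin

text \<open>The lattice \<open>\<int>\<^sup>d\<close> is the type \<^typ>\<open>int ^ 'd\<close>, with \<open>d = CARD('d) \<ge> 1\<close>. Euclidean lengths and
  diameters are those of the image in \<^typ>\<open>real ^ 'd\<close>.\<close>

definition real_vec :: "int ^ 'd \<Rightarrow> real ^ 'd::finite" where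
  "real_vec n = (\<chi> i. real_of_int (n $ i))"

definition prism :: "int ^ 'd \<Rightarrow> (int ^ 'd::finite) set" where
  "prism b = {n. \<forall>i. 0 \<le> n $ i \<and> n $ i \<le> b $ i}"

definition prism_diameter :: "int ^ 'd \<Rightarrow> real" where
  "prism_diameter b = diameter (real_vec ` prism (b :: int ^ 'd::finite))"

definition diag :: "int \<Rightarrow> int ^ 'd::finite" where
  "diag a = (\<chi> i. a)"

definition lattice_ball :: "real \<Rightarrow> (int ^ 'd::finite) set" where
  "lattice_ball r = {n. norm (real_vec n) \<le> r}"

locale measure_preserving_action = prob_space M for M :: "'a measure" +
  fixes T :: "int ^ 'd::finite \<Rightarrow> 'a \<Rightarrow> 'a"
  assumes measurable_action: "T n \<in> M \<rightarrow>\<^sub>M M"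
    and preserves_measure: "distr M M (T n) = M"
    and action_zero: "x \<in> space M \<Longrightarrow> T 0 x = x"
    and action_add: "x \<in> space M \<Longrightarrow> T n (T m x) = T (n + m) x"

text \<open>The fixed-point sets need not be measurable in an arbitrary probability space; measure 0 means
  being contained in a measurable null set.\<close>

definition aperiodic :: "'a measure \<Rightarrow> (int ^ 'd::finite \<Rightarrow> 'a \<Rightarrow> 'a) \<Rightarrow> bool" where
  "aperiodic M T \<longleftrightarrow> (\<forall>n. n \<noteq> 0 \<longrightarrow> (AE x in M. T n x \<noteq> x))"

definition set_average ::
    "(int ^ 'd::finite \<Rightarrow> 'a \<Rightarrow> 'a) \<Rightarrow> (int ^ 'd) set \<Rightarrow> ('a \<Rightarrow> complex) \<Rightarrow> 'a \<Rightarrow> complex" where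
  "set_average T F f x = (\<Sum>n\<in>F. f (T n x)) / of_nat (card F)"

text \<open>The average over the empty set is 0 here. For the families considered this concerns only
  bounded \<open>r\<close>, hence not the limit.\<close>

definition pointwise_L1_good ::
    "'a measure \<Rightarrow> (int ^ 'd::finite \<Rightarrow> 'a \<Rightarrow> 'a) \<Rightarrow> (real \<Rightarrow> (int ^ 'd) set) \<Rightarrow> bool" where
  "pointwise_L1_good M T F \<longleftrightarrow>
     (\<forall>f :: 'a \<Rightarrow> complex. integrable M f \<longrightarrow>
        (AE x in M. \<exists>L. ((\<lambda>r. set_average T (F r) f x) \<longlongrightarrow> L) at_top))"

end

theory Submission imports Defs begin

text \<open>The averages over \<open>S \<inter> B\<^sub>r\<close> are dominated by averages over cubes \<open>z + [0, s]\<^sup>d\<close> of comparable size: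
  one cube at the origin for the early prisms, one for the last complete prism, and one for the prism
  that the sphere of radius \<open>r\<close> is cutting. Since \<open>\<ell>\<^sub>k \<ge> C |a\<^sub>k\<^sub>-\<^sub>1|\<close>, the pairs \<open>(z, s)\<close> that occur satisfy the
  cone condition of Bellow, Jones and Rosenblatt: a Vitali covering argument on the lattice, transferred
  to the action, gives a weak type (1, 1) maximal inequality. So almost everywhere convergence need only
  be checked on a dense set. Because \<open>\<ell>\<^sub>k\<close> is superlacunary and the corners lie on the diagonal, the sets
  \<open>S \<inter> B\<^sub>r\<close> are asymptotically invariant, hence bounded coboundaries average to 0. Finally, minimizing
  the \<open>L\<^sup>2\<close> norm over the midpoint-convex hull of the orbit of a bounded \<open>f\<close> yields an invariant
  limit \<open>h\<close>, and shows that \<open>f\<close> is a limit in \<open>L\<^sup>1\<close> of functions that differ from \<open>h\<close> by coboundaries.\<close>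

section \<open>Covering on the lattice\<close>

text \<open>The obstacle is the prism being cut. Just after r passes |a_k| it contributes only a few
  points, at a distance from the origin far beyond their extent, and small cubes at arbitrarily
  remote corners would violate the cone condition. By then, however, all of prism k-1 lies in the
  ball, so S \<inter> B_r already has at least a constant times l_{k-1}^d points. The cube for the
  cut piece can therefore be enlarged to side at least l_{k-1} at bounded cost, and the corner a_k
  enters the cone sections only from height l_{k-1} on. As l_{k-1} \<ge> C|a_{k-2}|, all corners
  that have entered at height \<sigma>, except the last two, lie within \<sigma>/C of the origin.
  The same comparison with prism k-1 gives invariance: the cut piece is either long in every
  direction, so that its boundary is a small fraction of it, or negligible beside prism k-1. This
  dichotomy needs a piece with comparable sides, which diagonal corners provide.\<close>

lemma interval_vec_eq_image:
  fixes u v :: "int ^ 'd::finite"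
  shows "{u..v} = vec_lambda ` (PiE UNIV (\<lambda>i. {u $ i..v $ i}))"
proof (intro equalityI subsetI)
  fix x assume "x \<in> {u..v}"
  then have "vec_nth x \<in> PiE UNIV (\<lambda>i. {u $ i..v $ i})"
    by (auto simp: less_eq_vec_def PiE_iff)
  then show "x \<in> vec_lambda ` (PiE UNIV (\<lambda>i. {u $ i..v $ i}))"
    by (metis (no_types, lifting) image_eqI vec_nth_inverse)
qed (auto simp: less_eq_vec_def PiE_iff)

lemma finite_interval_vec [simp]: "finite {u..v :: int ^ 'd::finite}"
  by (auto simp: interval_vec_eq_image intro!: finite_PiE)

lemma card_interval_vec:
  "card {u..v :: int ^ 'd::finite} = (\<Prod>i\<in>UNIV. nat (v $ i - u $ i + 1))"
proof -
  have "card {u..v} = card (PiE (UNIV :: 'd set) (\<lambda>i. {u $ i..v $ i}))"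
    unfolding interval_vec_eq_image
    by (rule card_image) (auto intro!: inj_onI simp: vec_lambda_inject)
  also have "\<dots> = (\<Prod>i\<in>UNIV. nat (v $ i - u $ i + 1))"
    by (simp add: card_PiE algebra_simps)
  finally show ?thesis .
qed

lemma card_interval_diag:
  assumes "p \<le> q + 1"
  shows "card {diag p..diag q :: int ^ 'd::finite} = nat (q - p + 1) ^ CARD('d)"
  by (simp add: card_interval_vec diag_def)

lemma prism_eq_interval: "prism b = {0..b}"
  by (auto simp: prism_def less_eq_vec_def)

text \<open>Greedy choice: keep a set with maximal \<open>s\<close>, discard every set that meets
  it, and recurse on the rest. A discarded set meets a kept one whose \<open>s\<close> is at least
  as large.\<close>

lemma finite_Vitali_selection:
  fixes J :: "'i \<Rightarrow> 'b set" and s :: "'i \<Rightarrow> nat"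
  assumes "finite I" "\<And>i. i \<in> I \<Longrightarrow> J i \<noteq> {}"
  obtains I' where "I' \<subseteq> I" "disjoint_family_on J I'"
    "\<And>i. i \<in> I \<Longrightarrow> \<exists>j\<in>I'. s i \<le> s j \<and> J i \<inter> J j \<noteq> {}"
proof -
  have "\<exists>I'\<subseteq>I. disjoint_family_on J I' \<and> (\<forall>i\<in>I. \<exists>j\<in>I'. s i \<le> s j \<and> J i \<inter> J j \<noteq> {})"
    using assms
  proof (induction I rule: finite_psubset_induct)
    case (psubset I)
    show ?case
    proof (cases "I = {}")
      case False
      obtain j where j: "j \<in> I" "\<And>i. i \<in> I \<Longrightarrow> s i \<le> s j"
        using Max_in[of "s ` I"] Max_ge[of "s ` I"] psubset.hyps False
        by (metis (no_types, lifting) finite_imageI imageE image_eqI image_is_empty)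
      define I2 where "I2 = {i \<in> I. J i \<inter> J j = {}}"
      have "I2 \<subset> I"
        using j(1) psubset.prems[OF j(1)] by (auto simp: I2_def)
      then obtain I' where I': "I' \<subseteq> I2" "disjoint_family_on J I'"
        "\<forall>i\<in>I2. \<exists>j\<in>I'. s i \<le> s j \<and> J i \<inter> J j \<noteq> {}"
        using psubset.IH[of I2] psubset.prems by blast
      have "disjoint_family_on J (insert j I')"
        using I'(1,2) by (fastforce simp: disjoint_family_on_def I2_def)
      moreover have "\<forall>i\<in>I. \<exists>k\<in>insert j I'. s i \<le> s k \<and> J i \<inter> J k \<noteq> {}"
        using I'(3) j by (auto simp: I2_def)
      ultimately show ?thesis
        using I'(1) j(1) by (intro exI[of _ "insert j I'"]) (auto simp: I2_def)
    qed (auto simp: disjoint_family_on_def)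
  qed
  then show thesis using that by blast
qed

definition cube :: "nat \<Rightarrow> (int ^ 'd::finite) set" where
  "cube s = {0..diag (int s)}"

lemma finite_cube [simp]: "finite (cube s)"
  by (simp add: cube_def)

lemma zero_in_cube [simp]: "0 \<in> cube s"
  by (simp add: cube_def less_eq_vec_def diag_def)

lemma card_cube: "card (cube s :: (int ^ 'd::finite) set) = (s + 1) ^ CARD('d)"
proof -
  have "cube s = {diag 0..diag (int s) :: int ^ 'd}"
    by (simp add: cube_def diag_def less_eq_vec_def atLeastAtMost_def atLeast_def atMost_def)
  then show ?thesis
    using card_interval_diag[of 0 "int s", where 'd='d] by (simp add: nat_add_distrib)
qed

text \<open>The cross-section at height \<open>\<sigma>\<close> of the union of the cones over the points of \<open>Fam\<close>. Its
  linear growth is the condition of Bellow, Jones and Rosenblatt for moving averages.\<close>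

definition cone_section :: "((int ^ 'd::finite) \<times> nat) set \<Rightarrow> nat \<Rightarrow> (int ^ 'd) set" where
  "cone_section Fam \<sigma> =
     (\<Union>(z, s)\<in>{p \<in> Fam. snd p \<le> \<sigma>}. {z - diag (int \<sigma>)..z + diag (int \<sigma>)})"

definition cone_condition :: "((int ^ 'd::finite) \<times> nat) set \<Rightarrow> real \<Rightarrow> bool" where
  "cone_condition Fam A \<longleftrightarrow> (\<forall>\<sigma>. finite (cone_section Fam \<sigma>) \<and>
     real (card (cone_section Fam \<sigma>)) \<le> A * (real \<sigma> + 1) ^ CARD('d))"

lemma cone_condition_subset:
  assumes "cone_condition Fam A" "Fam' \<subseteq> Fam"
  shows "cone_condition Fam' A"
  unfolding cone_condition_def
proof
  fix \<sigma>
  have sub: "cone_section Fam' \<sigma> \<subseteq> cone_section Fam \<sigma>"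
    using assms(2) by (auto simp: cone_section_def)
  moreover have fin: "finite (cone_section Fam \<sigma>)"
    and le: "real (card (cone_section Fam \<sigma>)) \<le> A * (real \<sigma> + 1) ^ CARD('a)"
    using assms(1) by (auto simp: cone_condition_def)
  ultimately show "finite (cone_section Fam' \<sigma>) \<and>
      real (card (cone_section Fam' \<sigma>)) \<le> A * (real \<sigma> + 1) ^ CARD('a)"
    using card_mono[OF fin sub] finite_subset[OF sub fin] le by linarith
qed

text \<open>Select disjoint windows \<open>J j\<close>. If \<open>J i\<close> meets
  \<open>J j\<close> and \<open>s i \<le> s j\<close>, then \<open>j + z j - i\<close> differs from
  \<open>z i\<close> by at most \<open>s j\<close> in each coordinate, so it lies in
  \<open>cone_section Fam (s j)\<close>. Each selected \<open>j\<close> thus accounts for at most A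
  (s j + 1)^d points of \<open>E\<close>, which its own window pays for through
  \<open>\<phi>\<close>; by disjointness the payments add up inside \<open>Y\<close>.\<close>

lemma covering_inequality:
  fixes \<phi> :: "int ^ 'd::finite \<Rightarrow> real"
  assumes cone: "cone_condition Fam A" and "A \<ge> 0" and fin: "finite E" "finite Y"
    and \<phi>: "\<And>m. \<phi> m \<ge> 0" and "t > 0"
    and E: "\<And>n. n \<in> E \<Longrightarrow> \<exists>(z, s)\<in>Fam. (+) (n + z) ` cube s \<subseteq> Y \<and>
      t * (real s + 1) ^ CARD('d) \<le> sum \<phi> ((+) (n + z) ` cube s)"
  shows "t * card E \<le> A * sum \<phi> Y"
proof -
  obtain z s where zs: "\<And>n. n \<in> E \<Longrightarrow> (z n, s n) \<in> Fam \<and> (+) (n + z n) ` cube (s n) \<subseteq> Y \<and>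
      t * (real (s n) + 1) ^ CARD('d) \<le> sum \<phi> ((+) (n + z n) ` cube (s n))"
    using E by (simp add: Bex_def split_paired_Ex) metis
  define J where "J n = (+) (n + z n) ` cube (s n)" for n
  obtain E' where E': "E' \<subseteq> E" "disjoint_family_on J E'"
    "\<And>i. i \<in> E \<Longrightarrow> \<exists>j\<in>E'. s i \<le> s j \<and> J i \<inter> J j \<noteq> {}"
    using finite_Vitali_selection[OF fin(1), of J s] by (auto simp: J_def) (metis empty_iff zero_in_cube)
  have finE': "finite E'"
    using E'(1) fin(1) finite_subset by blast
  define W where "W j = (\<lambda>w. j + z j - w) ` cone_section Fam (s j)" for j
  have finW: "finite (W j)" for j
    using cone by (auto simp: W_def cone_condition_def)
  have "E \<subseteq> (\<Union>j\<in>E'. W j)"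
  proof
    fix i assume i: "i \<in> E"
    obtain j where j: "j \<in> E'" "s i \<le> s j" "J i \<inter> J j \<noteq> {}"
      using E'(3)[OF i] by blast
    then obtain p q where pq: "p \<in> cube (s i)" "q \<in> cube (s j)" "i + z i + p = j + z j + q"
      by (auto simp: J_def)
    have "j + z j - i \<in> {z i - diag (int (s j))..z i + diag (int (s j))}"
    proof -
      have "j $ x + z j $ x - i $ x = z i $ x + p $ x - q $ x" for x
        using arg_cong[OF pq(3), of "\<lambda>v. v $ x"] by simp
      moreover have "0 \<le> p $ x \<and> p $ x \<le> int (s i)" "0 \<le> q $ x \<and> q $ x \<le> int (s j)" for x
        using pq(1,2) by (auto simp: cube_def less_eq_vec_def diag_def)
      ultimately show ?thesis
        using j(2) unfolding atLeastAtMost_iff less_eq_vec_def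
        by (simp add: diag_def) (smt (verit) of_nat_le_iff)
    qed
    then have "j + z j - i \<in> cone_section Fam (s j)"
      using zs[OF i] j(2) by (auto simp: cone_section_def)
    then have "i \<in> W j"
      unfolding W_def by (rule rev_image_eqI) simp
    then show "i \<in> (\<Union>j\<in>E'. W j)" using j(1) by blast
  qed
  then have "card E \<le> card (\<Union>j\<in>E'. W j)"
    using finW finE' by (intro card_mono) auto
  also have "\<dots> \<le> (\<Sum>j\<in>E'. card (W j))"
    using finE' by (rule card_UN_le)
  finally have "t * card E \<le> t * (\<Sum>j\<in>E'. real (card (W j)))"
    using \<open>t > 0\<close> by (simp flip: of_nat_sum)
  also have "\<dots> = (\<Sum>j\<in>E'. t * card (W j))"
    by (simp add: sum_distrib_left)
  also have "\<dots> \<le> (\<Sum>j\<in>E'. A * sum \<phi> (J j))"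
  proof (rule sum_mono)
    fix j assume j: "j \<in> E'"
    have "card (W j) \<le> card (cone_section Fam (s j))"
      unfolding W_def by (rule card_image_le) (use cone in \<open>auto simp: cone_condition_def\<close>)
    then have "real (card (W j)) \<le> A * (real (s j) + 1) ^ CARD('d)"
      using cone by (metis cone_condition_def of_nat_mono order_trans)
    then have "t * card (W j) \<le> A * (t * (real (s j) + 1) ^ CARD('d))"
      using \<open>t > 0\<close> by (metis mult.left_commute mult_le_cancel_left_pos)
    also have "\<dots> \<le> A * sum \<phi> (J j)"
      using zs[of j] j E'(1) \<open>A \<ge> 0\<close> by (intro mult_left_mono) (auto simp: J_def)
    finally show "t * card (W j) \<le> A * sum \<phi> (J j)" .
  qed
  also have "\<dots> = A * sum \<phi> (\<Union>j\<in>E'. J j)"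
    using E'(2) finE'
    by (subst sum.UNION_disjoint) (auto simp: J_def disjoint_family_on_def sum_distrib_left)
  also have "\<dots> \<le> A * sum \<phi> Y"
    using zs E'(1) \<open>A \<ge> 0\<close> \<phi> fin(2)
    by (intro mult_left_mono sum_mono2) (auto simp: J_def)
  finally show ?thesis .
qed

definition escape :: "int ^ 'd::finite \<Rightarrow> (int ^ 'd) set \<Rightarrow> real" where
  "escape v F = card {n \<in> F. n + v \<notin> F}"

text \<open>The Folner condition. Counting departures is enough: \<open>F r\<close> and its
  translate have equally many points, so their symmetric difference is twice the escaping
  part.\<close>

definition asymptotically_invariant :: "(real \<Rightarrow> (int ^ 'd::finite) set) \<Rightarrow> bool" where
  "asymptotically_invariant F \<longleftrightarrow>
     (\<forall>r. finite (F r)) \<and> (\<forall>v. ((\<lambda>r. escape v (F r) / card (F r)) \<longlongrightarrow> 0) at_top)"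

section \<open>The maximal inequality\<close>

context measure_preserving_action
begin

lemma action_in_space: "x \<in> space M \<Longrightarrow> T n x \<in> space M"
  using measurable_action measurable_space by metis

lemma integrable_action:
  fixes f :: "'a \<Rightarrow> 'c::{banach, second_countable_topology}"
  shows "integrable M f \<Longrightarrow> integrable M (\<lambda>x. f (T n x))"
  using integrable_distr[OF measurable_action[of n], of f] by (simp add: preserves_measure)

lemma integral_action:
  fixes f :: "'a \<Rightarrow> 'c::{banach, second_countable_topology}"
  shows "f \<in> borel_measurable M \<Longrightarrow> (\<integral>x. f (T n x) \<partial>M) = integral\<^sup>L M f"
  using integral_distr[OF measurable_action[of n], of f] by (simp add: preserves_measure)

text \<open>Superlevel set of the moving maximal function of \<open>Fam\<close>; the factor
  multiplying \<open>t\<close> is the number of points of \<open>cube s\<close>.\<close>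

definition exceedance :: "((int ^ 'd) \<times> nat) set \<Rightarrow> ('a \<Rightarrow> complex) \<Rightarrow> real \<Rightarrow> 'a set" where
  "exceedance Fam e t = {x \<in> space M. \<exists>(z, s)\<in>Fam.
     t * (real s + 1) ^ CARD('d) < (\<Sum>n\<in>(+) z ` cube s. norm (e (T n x)))}"

lemma exceedance_sets:
  assumes [measurable]: "e \<in> borel_measurable M"
  shows "exceedance Fam e t \<in> sets M"
proof -
  have [measurable]: "(\<lambda>x. norm (e (T n x))) \<in> borel_measurable M" for n
    using measurable_compose[OF measurable_action assms] by simp
  have "exceedance Fam e t = (\<Union>p\<in>Fam. {x \<in> space M. t * (real (snd p) + 1) ^ CARD('d)
      < (\<Sum>n\<in>(+) (fst p) ` cube (snd p). norm (e (T n x)))})"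
    by (auto simp: exceedance_def)
  also have "\<dots> \<in> sets M"
    by (intro sets.countable_UN'') auto
  finally show ?thesis .
qed

text \<open>Transference: along one orbit, the times of visit to the exceedance set form a finite
  \<open>E\<close> to which \<open>covering_inequality\<close> applies, with
  \<open>\<phi> m = norm (e (T m x))\<close>. Points of a window are n + z + q with coordinates in
  [0, N], [-L, L] and [0, L] respectively, whence the ambient box.\<close>

lemma exceedance_orbit:
  assumes "cone_condition Fam A" "A \<ge> 0" "t > 0" and x: "x \<in> space M"
    and L: "\<And>z s i. (z, s) \<in> Fam \<Longrightarrow> \<bar>z $ i\<bar> \<le> int L \<and> s \<le> L"
  shows "t * (\<Sum>n\<in>cube N. indicator (exceedance Fam e t) (T n x))
    \<le> A * (\<Sum>m\<in>{diag (- int L)..diag (int N + 2 * int L)}. norm (e (T m x)))"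
proof -
  define E where "E = {n \<in> cube N. T n x \<in> exceedance Fam e t}"
  have "t * card E \<le> A * (\<Sum>m\<in>{diag (- int L)..diag (int N + 2 * int L)}. norm (e (T m x)))"
  proof (rule covering_inequality[OF assms(1,2)])
    fix n assume n: "n \<in> E"
    then obtain z s where zs: "(z, s) \<in> Fam"
      "t * (real s + 1) ^ CARD('d) < (\<Sum>m\<in>(+) z ` cube s. norm (e (T m (T n x))))"
      by (auto simp: E_def exceedance_def)
    have "(+) (n + z) ` cube s \<subseteq> {diag (- int L)..diag (int N + 2 * int L)}"
    proof clarify
      fix q :: "int ^ 'd" assume q: "q \<in> cube s"
      have "- int L \<le> n $ i + z $ i + q $ i \<and> n $ i + z $ i + q $ i \<le> int N + 2 * int L" for i
        using q n L[OF zs(1), of i] by (auto simp: E_def cube_def less_eq_vec_def diag_def) (smt (verit) of_nat_le_iff)+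
      then show "n + z + q \<in> {diag (- int L)..diag (int N + 2 * int L)}"
        by (simp add: less_eq_vec_def diag_def)
    qed
    moreover have "(\<Sum>m\<in>(+) z ` cube s. norm (e (T m (T n x))))
        = (\<Sum>m\<in>(+) (n + z) ` cube s. norm (e (T m x)))"
      by (subst (1 2) sum.reindex) (auto simp: action_add[OF x] algebra_simps)
    ultimately show "\<exists>(z, s)\<in>Fam. (+) (n + z) ` cube s \<subseteq> {diag (- int L)..diag (int N + 2 * int L)} \<and>
      t * (real s + 1) ^ CARD('d) \<le> (\<Sum>m\<in>(+) (n + z) ` cube s. norm (e (T m x)))"
      using zs by (intro bexI[of _ "(z, s)"]) auto
  qed (auto simp: E_def \<open>t > 0\<close>)
  moreover have "(\<Sum>n\<in>cube N. indicator (exceedance Fam e t) (T n x)) = real (card E)"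
    unfolding E_def indicator_def by (simp add: sum.If_cases Int_def)
  ultimately show ?thesis by simp
qed

text \<open>After integration, measure preservation turns both orbit sums into multiples of a single
  integral. The box has N + 3L + 1 points per side against N + 1 for the cube, and the ratio tends
  to 1 because \<open>L\<close> stays fixed as N grows.\<close>

lemma weak_type_bounded:
  assumes "cone_condition Fam A" "A \<ge> 0" "t > 0" and e: "integrable M e"
    and L: "\<And>z s i. (z, s) \<in> Fam \<Longrightarrow> \<bar>z $ i\<bar> \<le> int L \<and> s \<le> L"
  shows "t * prob (exceedance Fam e t) \<le> A * (\<integral>x. norm (e x) \<partial>M)"
proof -
  define V where "V = exceedance Fam e t"
  have e_meas: "e \<in> borel_measurable M" using e by auto
  have V [measurable]: "V \<in> sets M"
    unfolding V_def by (rule exceedance_sets[OF e_meas])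
  have intV: "integrable M (\<lambda>x. indicator V x :: real)"
    using V by (simp add: emeasure_eq_measure)
  have "t * ((real N + 1) ^ CARD('d) * prob V)
      \<le> A * ((real N + 3 * real L + 1) ^ CARD('d) * (\<integral>x. norm (e x) \<partial>M))" for N
  proof -
    let ?Y = "{diag (- int L)..diag (int N + 2 * int L)} :: (int ^ 'd) set"
    have cardY: "real (card ?Y) = (real N + 3 * real L + 1) ^ CARD('d)"
      by (subst card_interval_diag) (auto simp: of_nat_nat algebra_simps)
    have "t * ((real N + 1) ^ CARD('d) * prob V) = t * (\<Sum>n\<in>(cube N :: (int ^ 'd) set). prob V)"
      by (simp add: card_cube add.commute)
    also have "\<dots> = t * (\<Sum>n\<in>cube N. \<integral>x. indicator V (T n x) \<partial>M)"
      using integral_action[of "indicator V :: 'a \<Rightarrow> real"] by simp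
    also have "\<dots> = (\<integral>x. t * (\<Sum>n\<in>cube N. indicator V (T n x)) \<partial>M)"
      by (subst integral_mult_right_zero, subst Bochner_Integration.integral_sum)
        (auto intro!: integrable_action[OF intV])
    also have "\<dots> \<le> (\<integral>x. A * (\<Sum>m\<in>?Y. norm (e (T m x))) \<partial>M)"
      using integrable_action[OF intV] integrable_action[OF e] exceedance_orbit[OF assms(1-3) _ L]
      by (intro integral_mono integrable_mult_right integrable_sum integrable_norm)
        (auto simp: V_def)
    also have "\<dots> = A * (\<Sum>m\<in>?Y. \<integral>x. norm (e (T m x)) \<partial>M)"
      by (subst integral_mult_right_zero, subst Bochner_Integration.integral_sum)
        (auto intro!: integrable_norm integrable_action[OF e])
    also have "\<dots> = A * (\<Sum>m\<in>?Y. \<integral>x. norm (e x) \<partial>M)"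
      using integral_action[of "\<lambda>x. norm (e x)"] e_meas by simp
    also have "\<dots> = A * ((real N + 3 * real L + 1) ^ CARD('d) * (\<integral>x. norm (e x) \<partial>M))"
      by (simp add: cardY)
    finally show ?thesis .
  qed
  then have "t * prob V \<le> A * (((real N + 3 * real L + 1) / (real N + 1)) ^ CARD('d) * (\<integral>x. norm (e x) \<partial>M))" for N
    by (simp add: power_divide field_simps)
  moreover have "(\<lambda>N. A * (((real N + 3 * real L + 1) / (real N + 1)) ^ CARD('d) * (\<integral>x. norm (e x) \<partial>M)))
      \<longlonglongrightarrow> A * (1 ^ CARD('d) * (\<integral>x. norm (e x) \<partial>M))"
  proof (intro tendsto_intros)
    have "(\<lambda>N. 1 + 3 * real L * (1 / (real N + 1))) \<longlonglongrightarrow> 1 + 3 * real L * 0"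
      using LIMSEQ_Suc[OF lim_1_over_n] by (intro tendsto_intros) (simp add: add.commute)
    moreover have "1 + 3 * real L * (1 / (real N + 1)) = (real N + 3 * real L + 1) / (real N + 1)" for N
      by (simp add: field_simps)
    ultimately show "(\<lambda>N. (real N + 3 * real L + 1) / (real N + 1)) \<longlonglongrightarrow> 1"
      by simp
  qed
  ultimately show ?thesis
    unfolding V_def[symmetric] by (intro LIMSEQ_le_const[where a="t * prob V"]) auto
qed

text \<open>Subfamilies inherit the cone condition with the same \<open>A\<close>, so the bounded
  case is uniform in \<open>L\<close> and continuity of the measure from below removes the
  truncation.\<close>

lemma weak_type:
  assumes "cone_condition Fam A" "A \<ge> 0" "t > 0" and e: "integrable M e"
  shows "t * prob (exceedance Fam e t) \<le> A * (\<integral>x. norm (e x) \<partial>M)"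
proof -
  define G where "G L = {p \<in> Fam. (\<forall>i. \<bar>fst p $ i\<bar> \<le> int L) \<and> snd p \<le> L}" for L
  have e_meas: "e \<in> borel_measurable M" using e by auto
  have "exceedance Fam e t = (\<Union>L. exceedance (G L) e t)"
  proof (intro equalityI subsetI)
    fix x assume "x \<in> exceedance Fam e t"
    then obtain z s where zs: "x \<in> space M" "(z, s) \<in> Fam"
      "t * (real s + 1) ^ CARD('d) < (\<Sum>n\<in>(+) z ` cube s. norm (e (T n x)))"
      by (auto simp: exceedance_def)
    define L where "L = max s (Max (range (\<lambda>i. nat \<bar>z $ i\<bar>)))"
    have "nat \<bar>z $ i\<bar> \<le> L" for i
      unfolding L_def by (rule max.coboundedI2, rule Max_ge) auto
    then have "\<bar>z $ i\<bar> \<le> int L" for i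
      by (simp add: nat_le_iff)
    then have "(z, s) \<in> G L" using zs(2) by (auto simp: G_def L_def)
    then show "x \<in> (\<Union>L. exceedance (G L) e t)"
      using zs by (auto simp: exceedance_def)
  qed (auto simp: exceedance_def G_def)
  moreover have "incseq (\<lambda>L. exceedance (G L) e t)"
  proof (rule incseq_SucI)
    fix L
    have "G L \<subseteq> G (Suc L)"
      by (auto simp: G_def intro: order_trans[of _ "int L"])
    then show "exceedance (G L) e t \<subseteq> exceedance (G (Suc L)) e t"
      by (auto simp: exceedance_def)
  qed
  ultimately have "(\<lambda>L. t * prob (exceedance (G L) e t)) \<longlonglongrightarrow> t * prob (exceedance Fam e t)"
    using finite_Lim_measure_incseq[of "\<lambda>L. exceedance (G L) e t"] exceedance_sets[OF e_meas]
    by (intro tendsto_intros) auto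
  moreover have "t * prob (exceedance (G L) e t) \<le> A * (\<integral>x. norm (e x) \<partial>M)" for L
    using assms by (intro weak_type_bounded cone_condition_subset[OF assms(1)]) (auto simp: G_def)
  ultimately show ?thesis
    by (intro LIMSEQ_le_const2) auto
qed

end

section \<open>Convergence from a dense class\<close>

text \<open>Only the tolerances 1/(j+1) are quantified, so that the hypothesis can be verified for
  almost every point by a countable intersection although r is real.\<close>

lemma Cauchy_at_top_imp_convergent:
  fixes h :: "real \<Rightarrow> 'c::complete_space"
  assumes "\<And>j::nat. \<exists>R. \<forall>r\<ge>R. \<forall>r'\<ge>R. dist (h r) (h r') \<le> inverse (real (Suc j))"
  shows "\<exists>L. (h \<longlongrightarrow> L) at_top"
proof -
  have ev: "\<exists>R. \<forall>r\<ge>R. \<forall>r'\<ge>R. dist (h r) (h r') < \<epsilon>" if pos: "\<epsilon> > 0" for \<epsilon>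
  proof -
    obtain j where j: "inverse (real (Suc j)) < \<epsilon>"
      using reals_Archimedean[OF pos] by blast
    obtain R where "\<forall>r\<ge>R. \<forall>r'\<ge>R. dist (h r) (h r') \<le> inverse (real (Suc j))"
      using assms[of j] by blast
    then show ?thesis
      using j by (intro exI[of _ R]) fastforce
  qed
  have "Cauchy (\<lambda>n. h (real n))"
  proof (rule metric_CauchyI)
    fix \<epsilon> :: real assume "\<epsilon> > 0"
    then obtain R where "\<forall>r\<ge>R. \<forall>r'\<ge>R. dist (h r) (h r') < \<epsilon>"
      using ev by blast
    then show "\<exists>N. \<forall>m\<ge>N. \<forall>n\<ge>N. dist (h (real m)) (h (real n)) < \<epsilon>"
      by (intro exI[of _ "nat \<lceil>R\<rceil>"]) (auto simp: ceiling_le_iff nat_le_iff le_nat_iff)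
  qed
  then obtain L where L: "(\<lambda>n. h (real n)) \<longlonglongrightarrow> L"
    using Cauchy_convergent convergent_def by blast
  have "(h \<longlongrightarrow> L) at_top"
  proof (rule tendstoI)
    fix \<epsilon> :: real assume "\<epsilon> > 0"
    then obtain R where R: "\<forall>r\<ge>R. \<forall>r'\<ge>R. dist (h r) (h r') < \<epsilon> / 2"
      using ev half_gt_zero by blast
    have "\<forall>\<^sub>F n in sequentially. dist (h (real n)) L < \<epsilon> / 2"
      using tendstoD[OF L, of "\<epsilon> / 2"] \<open>\<epsilon> > 0\<close> by simp
    moreover have "\<forall>\<^sub>F n in sequentially. real n \<ge> R"
      using filterlim_real_sequentially by (simp add: filterlim_at_top)
    ultimately have "\<forall>\<^sub>F n in sequentially. dist (h (real n)) L < \<epsilon> / 2 \<and> real n \<ge> R"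
      by (rule eventually_conj)
    then obtain n where n: "dist (h (real n)) L < \<epsilon> / 2" "real n \<ge> R"
      using eventually_happens'[OF sequentially_bot] by blast
    have "dist (h r) L < \<epsilon>" if "r \<ge> R" for r
      using R n that dist_triangle[of "h r" L "h (real n)"] by force
    then show "\<forall>\<^sub>F r in at_top. dist (h r) L < \<epsilon>"
      using eventually_at_top_linorder by blast
  qed
  then show ?thesis by blast
qed

text \<open>The set where \<open>P\<close> fails need not be measurable. The intersection of the
  exceptional sets for the bounds 1/(j+1) is a measurable null set, and off it \<open>P\<close>
  holds almost everywhere.\<close>

lemma (in finite_measure) AE_of_small_exceptions:
  assumes "\<And>\<delta>. \<delta> > 0 \<Longrightarrow> \<exists>V\<in>sets M. measure M V \<le> \<delta> \<and> (AE x in M. x \<notin> V \<longrightarrow> P x)"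
  shows "AE x in M. P x"
proof -
  have "\<forall>j. \<exists>V\<in>sets M. measure M V \<le> inverse (real (Suc j)) \<and> (AE x in M. x \<notin> V \<longrightarrow> P x)"
    using assms by simp
  then obtain V where V: "\<And>j. V j \<in> sets M" "\<And>j. measure M (V j) \<le> inverse (real (Suc j))"
    "\<And>j. AE x in M. x \<notin> V j \<longrightarrow> P x"
    by metis
  have "measure M (\<Inter>j. V j) \<le> 0"
  proof (rule LIMSEQ_le_const[OF LIMSEQ_inverse_real_of_nat])
    have "measure M (\<Inter>j. V j) \<le> inverse (real (Suc j))" for j
      using finite_measure_mono[of "\<Inter>j. V j" "V j"] V(1,2)[of j] by (meson INT_lower UNIV_I order_trans)
    then show "\<exists>N. \<forall>j\<ge>N. measure M (\<Inter>j. V j) \<le> inverse (real (Suc j))" by blast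
  qed
  then have "(\<Inter>j. V j) \<in> null_sets M"
    using V(1) by (intro null_setsI) (auto simp: emeasure_eq_measure antisym_conv measure_nonneg)
  then have "AE x in M. x \<notin> (\<Inter>j. V j)"
    by (rule AE_not_in)
  moreover have "AE x in M. \<forall>j. x \<notin> V j \<longrightarrow> P x"
    using V(3) by (subst AE_all_countable) blast
  ultimately show ?thesis
    by eventually_elim auto
qed

lemma set_average_diff:
  "set_average T F (\<lambda>x. f x - g x) x = set_average T F f x - set_average T F g x"
  by (simp add: set_average_def sum_subtractf diff_divide_distrib)

context measure_preserving_action
begin

text \<open>The Banach principle: off a small set the averages of \<open>f - g\<close> are
  eventually small, so the averages of \<open>f\<close> oscillate little more than those of
  \<open>g\<close>. Stating the maximal hypothesis with a measurable \<open>V\<close> avoids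
  measurability of a supremum over uncountably many r.\<close>

lemma AE_convergent_of_approximation:
  assumes maximal: "\<And>e t. integrable M e \<Longrightarrow> t > 0 \<Longrightarrow>
      \<exists>V\<in>sets M. t * prob V \<le> A * (\<integral>x. norm (e x) \<partial>M) \<and>
        (\<forall>x\<in>space M - V. \<forall>\<^sub>F r in at_top. norm (set_average T (F r) e x) \<le> t)"
    and "A \<ge> 0"
    and f: "integrable M f"
    and approx: "\<And>\<delta>. \<delta> > 0 \<Longrightarrow> \<exists>g. integrable M g \<and> (\<integral>x. norm (f x - g x) \<partial>M) \<le> \<delta> \<and>
        (AE x in M. \<exists>L. ((\<lambda>r::real. set_average T (F r) g x) \<longlongrightarrow> L) at_top)"
  shows "AE x in M. \<exists>L. ((\<lambda>r. set_average T (F r) f x) \<longlongrightarrow> L) at_top"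
proof -
  let ?P = "\<lambda>\<epsilon> x. \<exists>R. \<forall>r\<ge>R. \<forall>r'\<ge>R. dist (set_average T (F r) f x) (set_average T (F r') f x) \<le> \<epsilon>"
  have "AE x in M. ?P \<epsilon> x" if pos: "\<epsilon> > 0" for \<epsilon>
  proof (rule AE_of_small_exceptions)
    fix \<delta> :: real assume "\<delta> > 0"
    \<comment> \<open>The divisor \<open>A + 1\<close> is positive even when \<open>A = 0\<close>.
      Below, \<epsilon>/3 from \<open>f - g\<close> and \<epsilon>/6 from \<open>g\<close> keep the
      averages of \<open>f\<close> within \<epsilon>/2 of \<open>L\<close>, hence within \<epsilon>
      of each other.\<close>
    define \<eta> where "\<eta> = \<delta> * (\<epsilon> / 3) / (A + 1)"
    have "\<eta> > 0" using \<open>\<delta> > 0\<close> \<open>\<epsilon> > 0\<close> \<open>A \<ge> 0\<close> by (simp add: \<eta>_def)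
    then obtain g where g: "integrable M g" "(\<integral>x. norm (f x - g x) \<partial>M) \<le> \<eta>"
      "AE x in M. \<exists>L. ((\<lambda>r::real. set_average T (F r) g x) \<longlongrightarrow> L) at_top"
      using approx by blast
    obtain V where V: "V \<in> sets M" "\<epsilon> / 3 * prob V \<le> A * (\<integral>x. norm (f x - g x) \<partial>M)"
      "\<And>x. x \<in> space M - V \<Longrightarrow> \<forall>\<^sub>F r in at_top. norm (set_average T (F r) (\<lambda>x. f x - g x) x) \<le> \<epsilon> / 3"
      using maximal[of "\<lambda>x. f x - g x" "\<epsilon> / 3"] f g(1) \<open>\<epsilon> > 0\<close> by auto
    have "\<epsilon> / 3 * prob V \<le> A * \<eta>"
      using V(2) g(2) \<open>A \<ge> 0\<close> by (meson mult_left_mono order_trans)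
    also have "\<dots> \<le> \<epsilon> / 3 * \<delta>"
      using \<open>A \<ge> 0\<close> \<open>\<epsilon> > 0\<close> \<open>\<delta> > 0\<close> by (simp add: \<eta>_def field_simps)
    finally have "prob V \<le> \<delta>"
      using \<open>\<epsilon> > 0\<close> by simp
    moreover have "AE x in M. x \<notin> V \<longrightarrow> ?P \<epsilon> x"
      using g(3) AE_space
    proof eventually_elim
      case (elim x)
      show ?case
      proof
        assume "x \<notin> V"
        obtain L where "((\<lambda>r::real. set_average T (F r) g x) \<longlongrightarrow> L) at_top"
          using elim(1) by blast
        then have "\<forall>\<^sub>F r in at_top. dist (set_average T (F r) g x) L < \<epsilon> / 6"
          using \<open>\<epsilon> > 0\<close> by (intro tendstoD) auto
        moreover have "\<forall>\<^sub>F r in at_top. norm (set_average T (F r) f x - set_average T (F r) g x) \<le> \<epsilon> / 3"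
          using V(3)[of x] elim(2) \<open>x \<notin> V\<close> by (simp add: set_average_diff)
        ultimately have "\<forall>\<^sub>F r in at_top. dist (set_average T (F r) f x) L \<le> \<epsilon> / 2"
        proof eventually_elim
          case (elim r)
          then show ?case
            using dist_triangle[of "set_average T (F r) f x" L "set_average T (F r) g x"]
            unfolding dist_norm by linarith
        qed
        then obtain R where R: "\<And>r. r \<ge> R \<Longrightarrow> dist (set_average T (F r) f x) L \<le> \<epsilon> / 2"
          by (auto simp: eventually_at_top_linorder)
        have "dist (set_average T (F r) f x) (set_average T (F r') f x) \<le> \<epsilon>" if "r \<ge> R" "r' \<ge> R" for r r'
          using R[OF that(1)] R[OF that(2)]
            dist_triangle2[of "set_average T (F r) f x" "set_average T (F r') f x" L] by linarith
        then show "?P \<epsilon> x" by blast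
      qed
    qed
    ultimately show "\<exists>V\<in>sets M. prob V \<le> \<delta> \<and> (AE x in M. x \<notin> V \<longrightarrow> ?P \<epsilon> x)"
      using V(1) by blast
  qed
  then have "AE x in M. \<forall>j::nat. ?P (inverse (real (Suc j))) x"
    by (subst AE_all_countable) simp
  then show ?thesis
    by eventually_elim (rule Cauchy_at_top_imp_convergent, rule spec)
qed

end

section \<open>Approximation by coboundaries\<close>

text \<open>The terms common to \<open>F\<close> and its translate cancel. The two remainders have
  equal size because the translate has as many points as \<open>F\<close>; hence the factor
  2.\<close>

lemma norm_shift_sum_diff_le:
  fixes h :: "'g::ab_group_add \<Rightarrow> 'c::real_normed_vector"
  assumes "finite F" and h: "\<And>n. norm (h n) \<le> B"
  shows "norm (\<Sum>n\<in>F. h n - h (n + v)) \<le> 2 * B * card {n \<in> F. n + v \<notin> F}"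
proof -
  let ?G = "(\<lambda>n. n + v) ` F" and ?c = "card {n \<in> F. n + v \<notin> F}"
  have fin: "finite ?G" using assms(1) by simp
  have G_F: "?G - F = (\<lambda>n. n + v) ` {n \<in> F. n + v \<notin> F}" by auto
  have cG: "card (?G - F) = ?c"
    unfolding G_F by (rule card_image) (auto intro!: inj_onI)
  have "card ?G = card F"
    by (rule card_image) (auto intro!: inj_onI)
  then have cF: "card (F - ?G) = ?c"
    using cG card_Int_Diff[OF fin, of F] card_Int_Diff[OF assms(1), of ?G] by (simp add: Int_commute)
  have "(\<Sum>n\<in>F. h n - h (n + v)) = sum h F - sum h ?G"
    by (simp add: sum_subtractf sum.reindex inj_on_def)
  also have "\<dots> = sum h (F - ?G) - sum h (?G - F)"
    using sum.Int_Diff[OF assms(1), of h ?G] sum.Int_Diff[OF fin, of h F] by (simp add: Int_commute)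
  finally have "norm (\<Sum>n\<in>F. h n - h (n + v)) \<le> norm (sum h (F - ?G)) + norm (sum h (?G - F))"
    by (simp add: norm_triangle_ineq4)
  also have "\<dots> \<le> of_nat (card (F - ?G)) * B + of_nat (card (?G - F)) * B"
    by (intro add_mono sum_norm_bound h)
  finally show ?thesis by (simp add: cF cG)
qed

lemma set_average_add:
  "set_average T F (\<lambda>x. f x + g x) x = set_average T F f x + set_average T F g x"
  by (simp add: set_average_def sum.distrib add_divide_distrib)

lemma set_average_half: "set_average T F (\<lambda>x. f x / 2) x = set_average T F f x / 2"
  by (simp add: set_average_def sum_divide_distrib[symmetric])

context measure_preserving_action
begin

lemma shift_coboundary_averages:
  assumes F: "asymptotically_invariant F" and x: "x \<in> space M"
    and g: "\<And>x. x \<in> space M \<Longrightarrow> norm (g x) \<le> B"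
  shows "((\<lambda>r. set_average T (F r) (\<lambda>x. g x - g (T v x)) x) \<longlongrightarrow> 0) at_top"
proof (rule Lim_null_comparison)
  show "((\<lambda>r. 2 * B * (escape v (F r) / card (F r))) \<longlongrightarrow> 0) at_top"
    using F by (intro tendsto_mult_right_zero) (auto simp: asymptotically_invariant_def)
  have "norm (set_average T (F r) (\<lambda>x. g x - g (T v x)) x)
      \<le> 2 * B * (escape v (F r) / card (F r))" for r
  proof -
    have "norm (\<Sum>n\<in>F r. g (T n x) - g (T (n + v) x)) \<le> 2 * B * escape v (F r)"
      using F x g unfolding escape_def by (intro norm_shift_sum_diff_le) (auto simp: asymptotically_invariant_def action_in_space escape_def)
    then show ?thesis
      by (simp add: set_average_def action_add[OF x] norm_divide divide_right_mono add.commute[of v])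
  qed
  then show "\<forall>\<^sub>F r in at_top. norm (set_average T (F r) (\<lambda>x. g x - g (T v x)) x)
      \<le> 2 * B * (escape v (F r) / card (F r))"
    by simp
qed

text \<open>Midpoints are all the convexity that the parallelogram law uses. With only these rules,
  measurability, the bound \<open>B\<close> and the vanishing of the averages of
  \<open>f - u\<close> are plain inductions.\<close>

inductive_set orbit_hull :: "('a \<Rightarrow> complex) \<Rightarrow> ('a \<Rightarrow> complex) set" for f where
  base: "f \<in> orbit_hull f"
| shift: "u \<in> orbit_hull f \<Longrightarrow> (\<lambda>x. u (T n x)) \<in> orbit_hull f"
| midpoint: "u \<in> orbit_hull f \<Longrightarrow> v \<in> orbit_hull f \<Longrightarrow> (\<lambda>x. (u x + v x) / 2) \<in> orbit_hull f"

lemma orbit_hull_measurable: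
  assumes "u \<in> orbit_hull f" "f \<in> borel_measurable M"
  shows "u \<in> borel_measurable M"
  using assms by induction (auto intro: measurable_compose[OF measurable_action])

lemma orbit_hull_bounded:
  assumes "u \<in> orbit_hull f" "\<And>x. x \<in> space M \<Longrightarrow> norm (f x) \<le> B" "x \<in> space M"
  shows "norm (u x) \<le> B"
  using assms(1,3)
proof (induction arbitrary: x)
  case (midpoint u v)
  have "norm ((u x + v x) / 2) = norm (u x + v x) / 2"
    by (simp add: norm_divide)
  also have "\<dots> \<le> B"
    using norm_triangle_ineq[of "u x" "v x"] midpoint.IH[OF midpoint.prems] by linarith
  finally show ?case .
qed (auto simp: assms(2) action_in_space)

text \<open>A shift by \<open>n\<close> adds the bounded coboundary
  \<open>\<lambda>x. u x - u (T n x)\<close> to \<open>f - u\<close>, and a midpoint takes the mean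
  of two such differences.\<close>

lemma orbit_hull_averages:
  assumes "u \<in> orbit_hull f" and F: "asymptotically_invariant F" and x: "x \<in> space M"
    and f: "\<And>x. x \<in> space M \<Longrightarrow> norm (f x) \<le> B"
  shows "((\<lambda>r. set_average T (F r) (\<lambda>x. f x - u x) x) \<longlongrightarrow> 0) at_top"
  using assms(1)
proof induction
  case base
  then show ?case by (simp add: set_average_def)
next
  case (shift u n)
  have "((\<lambda>r. set_average T (F r) (\<lambda>x. u x - u (T n x)) x) \<longlongrightarrow> 0) at_top"
    using orbit_hull_bounded[OF shift.hyps f] by (intro shift_coboundary_averages[OF F x]) auto
  from tendsto_add[OF shift.IH this] show ?case
    by (simp add: set_average_add[symmetric])
next
  case (midpoint u v)
  have "(\<lambda>x. f x - (u x + v x) / 2) = (\<lambda>x. ((f x - u x) + (f x - v x)) / 2)"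
    by (auto simp: field_simps)
  moreover have "((\<lambda>r. (set_average T (F r) (\<lambda>x. f x - u x) x + set_average T (F r) (\<lambda>x. f x - v x) x) / 2)
      \<longlongrightarrow> (0 + 0) / 2) at_top"
    by (intro tendsto_intros midpoint.IH) simp
  ultimately show ?case
    by (simp only: set_average_half set_average_add) simp
qed

section \<open>Minimal energy and the invariant limit\<close>

definition energy :: "('a \<Rightarrow> complex) \<Rightarrow> real" where
  "energy u = (\<integral>x. (norm (u x))\<^sup>2 \<partial>M)"

lemma integrable_bounded:
  fixes u :: "'a \<Rightarrow> 'c::{banach, second_countable_topology}"
  assumes "u \<in> borel_measurable M" "\<And>x. x \<in> space M \<Longrightarrow> norm (u x) \<le> B"
  shows "integrable M u"
  using assms by (intro integrable_const_bound[of _ B]) auto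

lemma integrable_norm_sq_bounded:
  fixes u :: "'a \<Rightarrow> complex"
  assumes "u \<in> borel_measurable M" "\<And>x. x \<in> space M \<Longrightarrow> norm (u x) \<le> B"
  shows "integrable M (\<lambda>x. (norm (u x))\<^sup>2)"
  using assms by (intro integrable_bounded[of _ "B\<^sup>2"]) (auto intro: power_mono)

lemma norm_diff_sq_eq:
  fixes a b :: complex
  shows "(norm (a - b))\<^sup>2 = 2 * (norm a)\<^sup>2 + 2 * (norm b)\<^sup>2 - 4 * (norm ((a + b) / 2))\<^sup>2"
  by (simp add: norm_divide power_divide cmod_power2) (simp add: power2_eq_square algebra_simps)

text \<open>Cauchy-Schwarz against the constant 1, obtained by integrating 2 \<eta> |u| \<le>
  \<eta>^2 + |u|^2.\<close>

lemma L1_le_of_energy_le: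
  assumes "u \<in> borel_measurable M" "\<And>x. x \<in> space M \<Longrightarrow> norm (u x) \<le> B"
    and "\<eta> > 0" "energy u \<le> \<eta>\<^sup>2"
  shows "(\<integral>x. norm (u x) \<partial>M) \<le> \<eta>"
proof -
  have "norm (u x) \<le> (\<eta> + (norm (u x))\<^sup>2 / \<eta>) / 2" for x
    using sum_squares_bound[of \<eta> "norm (u x)"] \<open>\<eta> > 0\<close> by (simp add: field_simps power2_eq_square)
  then have "(\<integral>x. norm (u x) \<partial>M) \<le> (\<integral>x. (\<eta> + (norm (u x))\<^sup>2 / \<eta>) / 2 \<partial>M)"
    using integrable_norm_sq_bounded[OF assms(1,2)] integrable_bounded[OF assms(1,2)]
    by (intro integral_mono) auto
  also have "\<dots> = (\<eta> + energy u / \<eta>) / 2"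
    using integrable_norm_sq_bounded[OF assms(1,2)] by (simp add: energy_def prob_space)
  also have "\<dots> \<le> \<eta>"
    using assms(3,4) by (simp add: field_simps power2_eq_square)
  finally show ?thesis .
qed

text \<open>By the parallelogram law, almost minimizers of the energy on the midpoint-convex set
  \<^term>\<open>orbit_hull f\<close> are close to each other.\<close>

lemma almost_minimizers_close:
  assumes f: "f \<in> borel_measurable M" "\<And>x. x \<in> space M \<Longrightarrow> norm (f x) \<le> B"
    and u: "u \<in> orbit_hull f" and v: "v \<in> orbit_hull f" and "\<eta> > 0"
    and "energy u \<le> Inf (energy ` orbit_hull f) + \<eta>\<^sup>2 / 4"
    and "energy v \<le> Inf (energy ` orbit_hull f) + \<eta>\<^sup>2 / 4"
  shows "(\<integral>x. norm (u x - v x) \<partial>M) \<le> \<eta>"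
proof (rule L1_le_of_energy_le[OF _ _ \<open>\<eta> > 0\<close>])
  note meas = orbit_hull_measurable[OF _ f(1)]
  have bd: "norm (u x) \<le> B" if "u \<in> orbit_hull f" "x \<in> space M" for u x
    using orbit_hull_bounded[OF that(1) f(2) that(2)] .
  have mid: "(\<lambda>x. (u x + v x) / 2) \<in> orbit_hull f"
    using u v by (rule midpoint)
  have int: "integrable M (\<lambda>x. (norm (w x))\<^sup>2)" if "w \<in> orbit_hull f" for w
    using integrable_norm_sq_bounded[OF meas bd, OF that that] by simp
  have "Inf (energy ` orbit_hull f) \<le> energy (\<lambda>x. (u x + v x) / 2)"
    by (intro cInf_lower bdd_belowI[of _ 0] imageI mid) (auto simp: energy_def)
  moreover have "energy (\<lambda>x. u x - v x)
      = 2 * energy u + 2 * energy v - 4 * energy (\<lambda>x. (u x + v x) / 2)"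
    unfolding energy_def norm_diff_sq_eq using int[OF u] int[OF v] int[OF mid] by simp
  \<comment> \<open>Each excess \<eta>^2/4 enters with factor 2, twice, for a total of \<eta>^2; the
    infima cancel because the midpoint has at least minimal energy.\<close>
  ultimately show "energy (\<lambda>x. u x - v x) \<le> \<eta>\<^sup>2"
    using assms(6,7) by linarith
  show "(\<lambda>x. u x - v x) \<in> borel_measurable M"
    using meas[OF u] meas[OF v] by simp
  show "norm (u x - v x) \<le> B + B" if "x \<in> space M" for x
    using norm_triangle_ineq4[of "u x" "v x"] bd[OF u that] bd[OF v that] by simp
qed

lemma energy_shift:
  assumes "u \<in> borel_measurable M"
  shows "energy (\<lambda>x. u (T n x)) = energy u"
  unfolding energy_def using assms by (intro integral_action) simp

lemma set_average_invariant:
  assumes "\<And>n. h (T n x) = h x" "F \<noteq> {}" "finite F"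
  shows "set_average T F h x = h x"
  using assms by (simp add: set_average_def)

lemma tendsto_set_average_invariant:
  assumes h: "\<And>n. AE x in M. h (T n x) = h x"
    and F: "asymptotically_invariant F" "\<forall>\<^sub>F r in at_top. F r \<noteq> {}"
  shows "AE x in M. ((\<lambda>r. set_average T (F r) h x) \<longlongrightarrow> h x) at_top"
proof -
  have "AE x in M. \<forall>n. h (T n x) = h x"
    using h by (subst AE_all_countable) blast
  then show ?thesis
  proof eventually_elim
    case (elim x)
    have "\<forall>\<^sub>F r in at_top. set_average T (F r) h x = h x"
      using F(2) by eventually_elim
        (use elim F(1) in \<open>auto simp: asymptotically_invariant_def intro: set_average_invariant\<close>)
    then show ?case by (rule tendsto_eventually)
  qed
qed

text \<open>The minimal-norm proof of the mean ergodic theorem, as in Alaoglu and Birkhoff. A shift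
  preserves energy, so a shifted almost minimizer is again one and stays close to the original; this
  makes the limit invariant. The minimizing sequence is Cauchy in L^1, a subsequence converges
  almost everywhere to \<open>h\<close>, and the bound \<open>B\<close> turns this into L^1
  convergence.\<close>

lemma orbit_hull_invariant_limit:
  assumes f: "f \<in> borel_measurable M" "\<And>x. x \<in> space M \<Longrightarrow> norm (f x) \<le> B"
  obtains w h where "\<And>j. w j \<in> orbit_hull f" "integrable M h"
    "\<And>n. AE x in M. h (T n x) = h x"
    "(\<lambda>j::nat. \<integral>x. norm (w j x - h x) \<partial>M) \<longlonglongrightarrow> 0"
proof -
  note meas = orbit_hull_measurable[OF _ f(1)]
  have bd: "norm (u x) \<le> B" if "u \<in> orbit_hull f" "x \<in> space M" for u x
    using orbit_hull_bounded[OF that(1) f(2) that(2)] .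
  note int = integrable_bounded[OF meas bd]
  let ?\<theta> = "Inf (energy ` orbit_hull f)" and ?\<eta> = "\<lambda>j. inverse (real (Suc j))"
  have "\<exists>u\<in>orbit_hull f. energy u < ?\<theta> + (?\<eta> j)\<^sup>2 / 4" for j
  proof (rule ccontr)
    assume "\<not> (\<exists>u\<in>orbit_hull f. energy u < ?\<theta> + (?\<eta> j)\<^sup>2 / 4)"
    then have "?\<theta> + (?\<eta> j)\<^sup>2 / 4 \<le> ?\<theta>"
      using orbit_hull.base by (intro cInf_greatest) (auto simp: not_less)
    moreover have "(?\<eta> j)\<^sup>2 > 0" by simp
    ultimately show False by linarith
  qed
  then obtain u where u: "\<And>j. u j \<in> orbit_hull f" "\<And>j. energy (u j) \<le> ?\<theta> + (?\<eta> j)\<^sup>2 / 4"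
    by (metis less_imp_le)
  have close: "(\<integral>x. norm (u i x - u j x) \<partial>M) \<le> ?\<eta> k" if "k \<le> i" "k \<le> j" for i j k
  proof -
    have "(?\<eta> i)\<^sup>2 \<le> (?\<eta> k)\<^sup>2" "(?\<eta> j)\<^sup>2 \<le> (?\<eta> k)\<^sup>2"
      using that by (auto intro!: power_mono le_imp_inverse_le)
    then have "energy (u i) \<le> ?\<theta> + (?\<eta> k)\<^sup>2 / 4" "energy (u j) \<le> ?\<theta> + (?\<eta> k)\<^sup>2 / 4"
      using u(2)[of i] u(2)[of j] by linarith+
    then show ?thesis
      by (intro almost_minimizers_close[OF f u(1) u(1)]) auto
  qed
  have shifted: "(\<integral>x. norm (u j (T n x) - u j x) \<partial>M) \<le> ?\<eta> j" for j n
    using u(2)[of j] energy_shift[OF meas[OF u(1)]]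
    by (intro almost_minimizers_close[OF f orbit_hull.shift[OF u(1)] u(1)]) auto
  have "\<exists>N. \<forall>i\<ge>N. \<forall>j\<ge>N. (\<integral>x. norm (u i x - u j x) \<partial>M) < e" if pos: "e > 0" for e
  proof -
    obtain k where "?\<eta> k < e" using reals_Archimedean[OF pos] by blast
    then show ?thesis using close[of k] by (meson le_less_trans)
  qed
  then obtain \<rho> where \<rho>: "strict_mono \<rho>" "AE x in M. Cauchy (\<lambda>i. u (\<rho> i) x)"
    using cauchy_L1_AE_cauchy_subseq[of M u] int[OF u(1) u(1)] by blast
  define w where "w i = u (\<rho> i)" for i
  define h where "h x = lim (\<lambda>i. w i x)" for x
  have w: "w j \<in> orbit_hull f" for j
    using u(1) by (simp add: w_def)
  have h_meas: "h \<in> borel_measurable M"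
    unfolding h_def using meas[OF w] by (rule borel_measurable_lim_metric)
  have lim: "AE x in M. (\<lambda>i. w i x) \<longlonglongrightarrow> h x"
    using \<rho>(2)
  proof eventually_elim
    case (elim x)
    then show ?case
      unfolding h_def w_def using Cauchy_convergent_iff convergent_LIMSEQ_iff by blast
  qed
  have h_int: "integrable M h"
  proof (rule integrable_dominated_convergence[where s = w and w = "\<lambda>_. B"])
    show "AE x in M. norm (w i x) \<le> B" for i
      using bd[OF w] by auto
  qed (use lim h_meas meas[OF w] in auto)
  have conv: "(\<lambda>j. \<integral>x. norm (w j x - h x) \<partial>M) \<longlonglongrightarrow> (\<integral>x. 0 \<partial>M)"
  proof (rule integral_dominated_convergence[where w = "\<lambda>x. B + norm (h x)"])
    show "AE x in M. (\<lambda>j. norm (w j x - h x)) \<longlonglongrightarrow> 0"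
      using lim by eventually_elim (simp add: LIM_zero tendsto_norm_zero)
    show "AE x in M. norm (norm (w j x - h x)) \<le> B + norm (h x)" for j
      using AE_space
    proof eventually_elim
      case (elim x)
      then show ?case
        using norm_triangle_ineq4[of "w j x" "h x"] bd[OF w elim, of j] by simp
    qed
  qed (use h_meas meas[OF w] h_int in auto)
  have w_int: "integrable M (w j)" for j
    using int[OF w w] by simp
  have "AE x in M. h (T n x) = h x" for n
  proof -
    have hT: "integrable M (\<lambda>x. h (T n x))" and wT: "integrable M (\<lambda>x. w j (T n x))" for j
      using integrable_action h_int w_int by auto
    \<comment> \<open>Pass from \<open>h (T n x)\<close> to \<open>w j (T n x)\<close>, then to
      \<open>w j x\<close>, then to \<open>h x\<close>. The outer two distances agree by measure
      preservation, and the middle one is small since \<open>w j\<close> is almost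
      minimizing.\<close>
    have "(\<integral>x. norm (h (T n x) - h x) \<partial>M) \<le> 2 * (\<integral>x. norm (w j x - h x) \<partial>M) + ?\<eta> j" for j
    proof -
      have "(\<integral>x. norm (h (T n x) - h x) \<partial>M)
          \<le> (\<integral>x. norm (w j (T n x) - h (T n x)) + norm (w j (T n x) - w j x) + norm (w j x - h x) \<partial>M)"
      proof (rule integral_mono)
        fix x
        have "h (T n x) - h x = - (w j (T n x) - h (T n x)) + (w j (T n x) - w j x) + (w j x - h x)"
          by simp
        then show "norm (h (T n x) - h x)
            \<le> norm (w j (T n x) - h (T n x)) + norm (w j (T n x) - w j x) + norm (w j x - h x)"
          by (metis (no_types, lifting) norm_add_rule_thm norm_minus_cancel norm_triangle_ineq order_refl)
      qed (use hT wT h_int w_int in auto)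
      also have "\<dots> = (\<integral>x. norm (w j (T n x) - h (T n x)) \<partial>M)
          + (\<integral>x. norm (w j (T n x) - w j x) \<partial>M) + (\<integral>x. norm (w j x - h x) \<partial>M)"
        using hT wT h_int w_int by simp
      also have "(\<integral>x. norm (w j (T n x) - h (T n x)) \<partial>M) = (\<integral>x. norm (w j x - h x) \<partial>M)"
        using h_meas meas[OF w] by (intro integral_action) auto
      also have "(\<integral>x. norm (w j (T n x) - w j x) \<partial>M) \<le> ?\<eta> j"
      proof -
        have "?\<eta> (\<rho> j) \<le> ?\<eta> j"
          using seq_suble[OF \<rho>(1), of j] by (intro le_imp_inverse_le) auto
        then show ?thesis unfolding w_def by (rule order_trans[OF shifted])
      qed
      finally show ?thesis by simp
    qed
    moreover have "(\<lambda>j. 2 * (\<integral>x. norm (w j x - h x) \<partial>M) + ?\<eta> j) \<longlonglongrightarrow> 2 * 0 + 0"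
      using conv LIMSEQ_inverse_real_of_nat by (intro tendsto_intros) auto
    ultimately have "(\<integral>x. norm (h (T n x) - h x) \<partial>M) \<le> 2 * 0 + 0"
      by (intro LIMSEQ_le_const) auto
    then have "(\<integral>x. norm (h (T n x) - h x) \<partial>M) = 0"
      by (simp add: order_antisym)
    then have "AE x in M. norm (h (T n x) - h x) = 0"
      using hT h_int by (subst (asm) integral_nonneg_eq_0_iff_AE) auto
    then show ?thesis by auto
  qed
  then show thesis
    using that[of w h] w h_int conv by simp
qed

text \<open>With \<open>g = f - w j + h\<close>, the error \<open>f - g\<close> is
  \<open>w j - h\<close>, small in L^1, while \<open>f - w j\<close> averages to 0 and
  \<open>h\<close> is invariant.\<close>

lemma bounded_approximation:
  assumes f: "f \<in> borel_measurable M" "\<And>x. x \<in> space M \<Longrightarrow> norm (f x) \<le> B"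
    and F: "asymptotically_invariant F" "\<forall>\<^sub>F r in at_top. F r \<noteq> {}" and "\<delta> > 0"
  shows "\<exists>g. integrable M g \<and> (\<integral>x. norm (f x - g x) \<partial>M) \<le> \<delta> \<and>
    (AE x in M. \<exists>L. ((\<lambda>r. set_average T (F r) g x) \<longlongrightarrow> L) at_top)"
proof -
  obtain w h where wh: "\<And>j. w j \<in> orbit_hull f" "integrable M h"
    "\<And>n. AE x in M. h (T n x) = h x"
    "(\<lambda>j::nat. \<integral>x. norm (w j x - h x) \<partial>M) \<longlonglongrightarrow> 0"
    using orbit_hull_invariant_limit[OF f] by blast
  obtain j where j: "(\<integral>x. norm (w j x - h x) \<partial>M) < \<delta>"
    using order_tendstoD(2)[OF wh(4) \<open>\<delta> > 0\<close>] eventually_happens'[OF sequentially_bot] by blast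
  define g where "g x = f x - w j x + h x" for x
  have "integrable M (w j)"
    by (rule integrable_bounded[OF orbit_hull_measurable[OF wh(1) f(1)] orbit_hull_bounded[OF wh(1) f(2)]])
  then have "integrable M g"
    unfolding g_def using wh(2) integrable_bounded[OF f] by simp
  moreover have "(\<integral>x. norm (f x - g x) \<partial>M) \<le> \<delta>"
    using j by (simp add: g_def)
  moreover have "AE x in M. ((\<lambda>r. set_average T (F r) h x) \<longlongrightarrow> h x) at_top"
    using tendsto_set_average_invariant[OF wh(3) F] by blast
  then have "AE x in M. \<exists>L. ((\<lambda>r. set_average T (F r) g x) \<longlongrightarrow> L) at_top"
    using AE_space
  proof eventually_elim
    case (elim x)
    have "((\<lambda>r. set_average T (F r) g x) \<longlongrightarrow> 0 + h x) at_top"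
      unfolding g_def set_average_add
      by (intro tendsto_add orbit_hull_averages[OF wh(1) F(1) elim(2) f(2)] elim(1))
    then show ?case by blast
  qed
  ultimately show ?thesis by blast
qed

end

section \<open>Asymptotic invariance and boxes\<close>

lemma escape_nonneg [simp]: "escape v F \<ge> 0"
  by (simp add: escape_def)

lemma escape_le_card: "finite F \<Longrightarrow> escape v F \<le> card F"
  unfolding escape_def by (simp add: card_mono)

lemma escape_Un_le:
  assumes "finite A" "finite B"
  shows "escape v (A \<union> B) \<le> escape v A + escape v B"
proof -
  have "card {n \<in> A \<union> B. n + v \<notin> A \<union> B} \<le> card ({n \<in> A. n + v \<notin> A} \<union> {n \<in> B. n + v \<notin> B})"
    using assms by (intro card_mono) auto
  also have "\<dots> \<le> card {n \<in> A. n + v \<notin> A} + card {n \<in> B. n + v \<notin> B}"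
    by (rule card_Un_le)
  finally show ?thesis by (simp add: escape_def)
qed

lemma escape_translate: "escape v ((+) z ` F) = escape v F"
proof -
  have "{n \<in> (+) z ` F. n + v \<notin> (+) z ` F} = (+) z ` {n \<in> F. n + v \<notin> F}"
    by (auto simp: image_iff add.assoc)
  then show ?thesis
    by (simp add: escape_def card_image)
qed

text \<open>A point lost under \<open>v + w\<close> is either lost under \<open>v\<close>, or
  survives \<open>v\<close> and then its image is lost under \<open>w\<close>.\<close>

lemma escape_add_le:
  assumes "finite F"
  shows "escape (v + w) F \<le> escape v F + escape w F"
proof -
  let ?A = "{n \<in> F. n + v \<in> F \<and> n + v + w \<notin> F}"
  have "card {n \<in> F. n + (v + w) \<notin> F} \<le> card ({n \<in> F. n + v \<notin> F} \<union> ?A)"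
    using assms by (intro card_mono) (auto simp: add.assoc)
  also have "\<dots> \<le> card {n \<in> F. n + v \<notin> F} + card ?A"
    by (rule card_Un_le)
  also have "card ?A \<le> card {n \<in> F. n + w \<notin> F}"
    using assms by (intro card_inj_on_le[of "\<lambda>n. n + v"]) (auto intro: inj_onI)
  finally show ?thesis by (simp add: escape_def)
qed

text \<open>Translation by \<open>v\<close> matches the points that stay in \<open>F\<close> under
  \<open>v\<close> with those that stay under \<open>- v\<close>.\<close>

lemma escape_minus:
  assumes "finite F"
  shows "escape (- v) F = escape v F"
proof -
  have compl: "escape w F = card F - card {n \<in> F. n + w \<in> F}" for w
  proof -
    have "F \<inter> {n. n + w \<in> F} = {n \<in> F. n + w \<in> F}" "F - {n. n + w \<in> F} = {n \<in> F. n + w \<notin> F}"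
      by auto
    then show ?thesis
      using card_Int_Diff[OF assms, of "{n. n + w \<in> F}"] by (simp add: escape_def)
  qed
  have "{n \<in> F. n + - v \<in> F} = (\<lambda>n. n + v) ` {n \<in> F. n + v \<in> F}"
    by (auto simp: image_iff) (metis diff_add_cancel)
  then have "card {n \<in> F. n + - v \<in> F} = card {n \<in> F. n + v \<in> F}"
    by (simp add: card_image)
  then show ?thesis by (simp only: compl)
qed

text \<open>Subadditivity and symmetry of \<open>escape\<close> make the vectors with vanishing
  escape ratio a subgroup, and the unit vectors generate the lattice.\<close>

lemma asymptotically_invariantI:
  fixes F :: "real \<Rightarrow> (int ^ 'd::finite) set"
  assumes fin: "\<And>r. finite (F r)"
    and ax: "\<And>i. ((\<lambda>r. escape (axis i 1) (F r) / card (F r)) \<longlongrightarrow> 0) at_top"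
  shows "asymptotically_invariant F"
proof -
  define good where "good v \<longleftrightarrow> ((\<lambda>r. escape v (F r) / card (F r)) \<longlongrightarrow> 0) at_top" for v
  have zero: "good 0"
    by (simp add: good_def escape_def)
  have add: "good (v + w)" if "good v" "good w" for v w
    unfolding good_def
  proof (rule Lim_null_comparison)
    show "((\<lambda>r. escape v (F r) / card (F r) + escape w (F r) / card (F r)) \<longlongrightarrow> 0) at_top"
      using tendsto_add[OF that[unfolded good_def]] by simp
    show "\<forall>\<^sub>F r in at_top. norm (escape (v + w) (F r) / card (F r))
        \<le> escape v (F r) / card (F r) + escape w (F r) / card (F r)"
      using escape_add_le[OF fin] by (auto simp: add_divide_distrib[symmetric] intro!: always_eventually divide_right_mono)
  qed
  have ax_k: "good (axis i k)" for i k
  proof (induction k rule: int_induct[where k=0])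
    case base
    have eq: "axis i (0::int) = (0 :: int ^ 'd)" by (simp add: axis_def vec_eq_iff)
    show ?case unfolding eq by (rule zero)
  next
    case (step1 k)
    have "axis i (k + 1) = axis i k + (axis i 1 :: int ^ 'd)" by (simp add: axis_def vec_eq_iff)
    then show ?case using add[OF step1(2)] ax by (simp add: good_def)
  next
    case (step2 k)
    have eq: "axis i (k - 1) = axis i k + - (axis i 1 :: int ^ 'd)" by (simp add: axis_def vec_eq_iff)
    have "good (- axis i 1)"
      using ax by (simp add: good_def escape_minus[OF fin])
    then show ?case unfolding eq by (rule add[OF step2(2)])
  qed
  have "good v" for v :: "int ^ 'd"
  proof -
    have "good (\<Sum>i\<in>I. axis i (v $ i))" if "finite I" for I
      using that by induction (auto simp: zero add ax_k)
    moreover have "(\<Sum>i\<in>UNIV. axis i (v $ i)) = v"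
      by (simp add: vec_eq_iff axis_def)
    ultimately show ?thesis by (metis finite)
  qed
  then show ?thesis
    using fin by (simp add: asymptotically_invariant_def good_def)
qed

section \<open>Counting points in boxes\<close>

lemma card_interval_zero:
  assumes "0 \<le> (m :: int ^ 'd::finite)"
  shows "real (card {0..m}) = (\<Prod>i\<in>UNIV. real_of_int (m $ i) + 1)"
proof -
  have "real (nat (m $ i - 0 $ i + 1)) = real_of_int (m $ i) + 1" for i
    using assms by (simp add: less_eq_vec_def)
  then show ?thesis by (simp add: card_interval_vec)
qed

lemma power_le_card_interval:
  assumes "0 \<le> (m :: int ^ 'd::finite)" "0 \<le> y" "\<And>i. y \<le> K * (real_of_int (m $ i) + 1)"
  shows "y ^ CARD('d) \<le> K ^ CARD('d) * card {0..m}"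
proof -
  have "y ^ CARD('d) = (\<Prod>i\<in>(UNIV::'d set). y)" by simp
  also have "\<dots> \<le> (\<Prod>i\<in>UNIV. K * (real_of_int (m $ i) + 1))"
    using assms(2,3) by (intro prod_mono) auto
  also have "\<dots> = K ^ CARD('d) * card {0..m}"
    using assms(1) by (simp add: card_interval_zero prod.distrib)
  finally show ?thesis .
qed

lemma card_interval_le_power:
  fixes y :: real
  assumes "0 \<le> (m :: int ^ 'd::finite)" "\<And>i. real_of_int (m $ i) + 1 \<le> y"
  shows "card {0..m} \<le> y ^ CARD('d)"
proof -
  have "real (card {0..m}) \<le> (\<Prod>i\<in>(UNIV::'d set). y)"
    unfolding card_interval_zero[OF assms(1)]
    using assms by (intro prod_mono) (auto simp: less_eq_vec_def add_nonneg_nonneg)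
  then show ?thesis by simp
qed

text \<open>A point that escapes from a down-set in direction \<open>i\<close> is the last one of its line in that
  direction, so the escaping points extend to disjoint segments of the ambient box.\<close>

lemma escape_downset:
  fixes P :: "(int ^ 'd::finite) set"
  assumes P: "P \<subseteq> {0..m}" and down: "\<And>x y. x \<in> P \<Longrightarrow> y \<in> {0..x} \<Longrightarrow> y \<in> P" and "0 \<le> m"
  shows "escape (axis i 1) P * (real_of_int (m $ i) + 1) \<le> card {0..m}"
proof -
  define E where "E = {x \<in> P. x + axis i 1 \<notin> P}"
  define \<phi> where "\<phi> = (\<lambda>(x :: int ^ 'd, s :: int). (\<chi> j. if j = i then s else x $ j) :: int ^ 'd)"
  have no_less: "\<not> x $ i < y $ i" if "x \<in> E" "y \<in> E" "\<And>j. j \<noteq> i \<Longrightarrow> x $ j = y $ j" for x y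
  proof
    assume less: "x $ i < y $ i"
    have "x \<in> {0..m}" using that(1) P by (auto simp: E_def)
    moreover have "(x + axis i 1) $ j \<le> y $ j" for j
      using less that(3)[of j] by (cases "j = i") (auto simp: axis_def)
    ultimately have "x + axis i 1 \<in> {0..y}"
      by (auto simp: less_eq_vec_def axis_def)
    then have "x + axis i 1 \<in> P" using down that(2) by (auto simp: E_def)
    then show False using that(1) by (simp add: E_def)
  qed
  have "inj_on \<phi> (E \<times> {0..m $ i})"
  proof (rule inj_onI, clarify)
    fix x s y t assume xy: "x \<in> E" "y \<in> E" and eq: "\<phi> (x, s) = \<phi> (y, t)"
    have off: "x $ j = y $ j" if "j \<noteq> i" for j
      using arg_cong[OF eq, of "\<lambda>v. v $ j"] that by (simp add: \<phi>_def)
    have "s = t"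
      using arg_cong[OF eq, of "\<lambda>v. v $ i"] by (simp add: \<phi>_def)
    moreover have "x $ i = y $ i"
      using no_less[OF xy] no_less[OF xy(2,1)] off by force
    then have "x = y" using off by (metis vec_eq_iff)
    ultimately show "x = y \<and> s = t" by simp
  qed
  moreover have "\<phi> ` (E \<times> {0..m $ i}) \<subseteq> {0..m}"
    using P by (fastforce simp: \<phi>_def E_def less_eq_vec_def)
  ultimately have "card (E \<times> {0..m $ i}) \<le> card {0..m}"
    by (intro card_inj_on_le) auto
  moreover have "real (card (E \<times> {0..m $ i})) = escape (axis i 1) P * (real_of_int (m $ i) + 1)"
    using \<open>0 \<le> m\<close> by (simp add: card_cartesian_product escape_def E_def less_eq_vec_def algebra_simps)
  ultimately show ?thesis by (metis of_nat_le_iff)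
qed

section \<open>Euclidean norms, diameters and balls\<close>

lemma norm_real_vec_sq: "(norm (real_vec x))\<^sup>2 = (\<Sum>i\<in>UNIV. (real_of_int (x $ i))\<^sup>2)"
  unfolding norm_vec_def L2_set_def by (simp add: real_vec_def sum_nonneg)

lemma component_le_norm_real_vec: "\<bar>real_of_int (x $ i)\<bar> \<le> norm (real_vec x)"
  using component_le_norm_cart[of "real_vec x" i] by (simp add: real_vec_def)

lemma norm_real_vec_mono:
  assumes "0 \<le> x" "x \<le> y"
  shows "norm (real_vec x) \<le> norm (real_vec y)"
proof (rule norm_le_componentwise_cart)
  fix i
  have "0 \<le> x $ i" "x $ i \<le> y $ i" using assms by (auto simp: less_eq_vec_def)
  then show "norm (real_vec x $ i) \<le> norm (real_vec y $ i)"
    by (simp add: real_vec_def)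
qed

text \<open>The diameter is attained at the opposite corners 0 and \<open>b\<close>.\<close>

lemma prism_diameter_eq:
  assumes "0 \<le> b"
  shows "prism_diameter b = norm (real_vec b)"
proof (rule antisym)
  show "prism_diameter b \<le> norm (real_vec b)"
    unfolding prism_diameter_def
  proof (rule diameter_le)
    fix x y assume "x \<in> real_vec ` prism b" "y \<in> real_vec ` prism b"
    then obtain p q where pq: "p \<in> prism b" "q \<in> prism b" "x = real_vec p" "y = real_vec q" by auto
    show "norm (x - y) \<le> norm (real_vec b)"
    proof (rule norm_le_componentwise_cart)
      fix i
      have "\<bar>p $ i - q $ i\<bar> \<le> \<bar>b $ i\<bar>" using pq(1,2) by (smt (verit) mem_Collect_eq prism_def)
      then show "norm ((x - y) $ i) \<le> norm (real_vec b $ i)"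
        by (simp add: pq(3,4) real_vec_def flip: of_int_diff)
    qed
  qed simp
  have "bounded (real_vec ` prism b)"
    by (intro finite_imp_bounded) (simp add: prism_eq_interval)
  from diameter_bounded_bound[OF this, of "real_vec b" "real_vec 0"]
  have "dist (real_vec b) (real_vec 0) \<le> prism_diameter b"
    using assms by (simp add: prism_diameter_def prism_eq_interval)
  then show "norm (real_vec b) \<le> prism_diameter b"
    by (simp add: dist_norm real_vec_def vec_eq_iff zero_vec_def[symmetric])
qed

text \<open>Since the corner lies on the diagonal, a ball cuts all edges at the corner at the same
  distance \<open>t\<close>. The piece cut off therefore lies between two boxes of comparable size.\<close>

lemma ball_corner_sandwich:
  fixes b :: "int ^ 'd::finite"
  assumes "0 \<le> b" "0 \<le> a" "norm (real_vec (diag a :: int ^ 'd)) \<le> r"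
  obtains t :: int where "0 \<le> t"
    "{x \<in> {0..b}. norm (real_vec (diag a + x)) \<le> r} \<subseteq> {0..\<chi> i. min t (b $ i)}"
    "{0..\<chi> i. min t (b $ i) div int CARD('d)} \<subseteq> {x \<in> {0..b}. norm (real_vec (diag a + x)) \<le> r}"
proof -
  let ?d = "int CARD('d)"
  have d: "?d > 0" by simp
  have "r \<ge> 0" using assms(3) norm_ge_zero order_trans by blast
  have in_ball: "norm (real_vec (diag a + x)) \<le> r \<longleftrightarrow>
      real_of_int (?d * a\<^sup>2 + 2 * a * (\<Sum>i\<in>UNIV. x $ i) + (\<Sum>i\<in>UNIV. (x $ i)\<^sup>2)) \<le> r\<^sup>2" for x :: "int ^ 'd"
  proof -
    have "norm (real_vec (diag a + x)) \<le> r \<longleftrightarrow> (norm (real_vec (diag a + x)))\<^sup>2 \<le> r\<^sup>2"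
      using \<open>r \<ge> 0\<close> by (simp add: abs_le_square_iff[symmetric])
    also have "(norm (real_vec (diag a + x)))\<^sup>2 = real_of_int (\<Sum>i\<in>UNIV. (a + x $ i)\<^sup>2)"
      by (simp add: norm_real_vec_sq diag_def)
    also have "(\<Sum>i\<in>UNIV. (a + x $ i)\<^sup>2) = ?d * a\<^sup>2 + 2 * a * (\<Sum>i\<in>UNIV. x $ i) + (\<Sum>i\<in>UNIV. (x $ i)\<^sup>2)"
      by (simp add: power2_sum sum.distrib sum_distrib_left mult.assoc)
    finally show ?thesis .
  qed
  \<comment> \<open>The integers t for which the corner moved by t along an edge stays in the ball.
    The condition is the same for all d edges because the coordinates of the corner are
    equal.\<close>
  define Q where "Q = {t. 0 \<le> t \<and> real_of_int (?d * a\<^sup>2 + 2 * a * t + t\<^sup>2) \<le> r\<^sup>2}"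
  have "Q \<subseteq> {0..\<lceil>r\<rceil>}"
  proof
    fix t assume t: "t \<in> Q"
    have "t\<^sup>2 \<le> ?d * a\<^sup>2 + 2 * a * t + t\<^sup>2"
      using t assms(2) by (simp add: Q_def)
    then have "real_of_int (t\<^sup>2) \<le> r\<^sup>2"
      using t unfolding Q_def mem_Collect_eq by (meson of_int_le_iff order_trans)
    then have "real_of_int t \<le> r"
      using \<open>r \<ge> 0\<close> by (intro power2_le_imp_le[of "real_of_int t" r]) auto
    then show "t \<in> {0..\<lceil>r\<rceil>}" using t by (auto simp: Q_def) linarith
  qed
  then have finQ: "finite Q" using finite_subset by blast
  have "0 \<in> Q"
    using in_ball[of 0] assms(3) by (simp add: Q_def)
  define t where "t = Max Q"
  have tQ: "t \<in> Q" using Max_in[OF finQ] \<open>0 \<in> Q\<close> unfolding t_def by blast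
  then have "0 \<le> t" by (simp add: Q_def)
  show thesis
  proof (rule that[OF \<open>0 \<le> t\<close>])
    show "{x \<in> {0..b}. norm (real_vec (diag a + x)) \<le> r} \<subseteq> {0..\<chi> i. min t (b $ i)}"
    proof clarify
      fix x assume x: "x \<in> {0..b}" "norm (real_vec (diag a + x)) \<le> r"
      have nn: "0 \<le> x $ i" for i using x(1) by (simp add: less_eq_vec_def)
      have "x $ i \<le> t" for i
      proof -
        \<comment> \<open>Dropping all coordinates of \<open>x\<close> but one can only shrink the
          norm, since \<open>x\<close> and the corner are nonnegative.\<close>
        have "x $ i \<le> (\<Sum>i\<in>UNIV. x $ i)" "(x $ i)\<^sup>2 \<le> (\<Sum>i\<in>UNIV. (x $ i)\<^sup>2)"
          using nn by (auto intro: member_le_sum)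
        then have "?d * a\<^sup>2 + 2 * a * x $ i + (x $ i)\<^sup>2
            \<le> ?d * a\<^sup>2 + 2 * a * (\<Sum>i\<in>UNIV. x $ i) + (\<Sum>i\<in>UNIV. (x $ i)\<^sup>2)"
          using assms(2) by (intro add_mono mult_left_mono) auto
        then have "x $ i \<in> Q"
          using x(2) nn unfolding Q_def in_ball mem_Collect_eq by (meson of_int_le_iff order_trans)
        then show ?thesis using finQ by (simp add: t_def)
      qed
      then show "x \<in> {0..\<chi> i. min t (b $ i)}"
        using x(1) by (simp add: less_eq_vec_def)
    qed
    \<comment> \<open>Coordinates at most t/d have sum at most t, and then the sum of squares is at
      most t times that sum, hence at most t^2: the box lies in the simplex spanned by the corner
      and the points at distance t on the edges.\<close>
    show "{0..\<chi> i. min t (b $ i) div ?d} \<subseteq> {x \<in> {0..b}. norm (real_vec (diag a + x)) \<le> r}"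
    proof
      fix x assume x: "x \<in> {0..\<chi> i. min t (b $ i) div ?d}"
      have nn: "0 \<le> x $ i" and le: "?d * x $ i \<le> min t (b $ i)" for i
      proof -
        show "0 \<le> x $ i" using x by (simp add: less_eq_vec_def)
        have "x $ i \<le> min t (b $ i) div ?d" using x by (simp add: less_eq_vec_def)
        then have "?d * x $ i \<le> ?d * (min t (b $ i) div ?d)" by simp
        also have "\<dots> \<le> min t (b $ i)"
          using mult_div_mod_eq[of ?d "min t (b $ i)"] pos_mod_sign[OF d, of "min t (b $ i)"] by linarith
        finally show "?d * x $ i \<le> min t (b $ i)" .
      qed
      have le1: "x $ i \<le> ?d * x $ i" for i
        using nn[of i] d by (simp add: mult_le_cancel_right1) 
      have "?d * (\<Sum>i\<in>UNIV. x $ i) = (\<Sum>i\<in>UNIV. ?d * x $ i)"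
        by (simp add: sum_distrib_left)
      also have "\<dots> \<le> (\<Sum>i\<in>(UNIV :: 'd set). t)"
        using le by (intro sum_mono) (meson min.boundedE)
      finally have s1: "(\<Sum>i\<in>UNIV. x $ i) \<le> t" using d by simp
      have "(\<Sum>i\<in>UNIV. (x $ i)\<^sup>2) \<le> (\<Sum>i\<in>UNIV. t * x $ i)"
        using le le1 nn by (intro sum_mono) (auto simp: power2_eq_square intro!: mult_right_mono intro: order_trans)
      also have "\<dots> = t * (\<Sum>i\<in>UNIV. x $ i)" by (simp add: sum_distrib_left)
      also have "\<dots> \<le> t\<^sup>2" using s1 \<open>0 \<le> t\<close> by (simp add: power2_eq_square mult_left_mono)
      finally have s2: "(\<Sum>i\<in>UNIV. (x $ i)\<^sup>2) \<le> t\<^sup>2" .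
      have "?d * a\<^sup>2 + 2 * a * (\<Sum>i\<in>UNIV. x $ i) + (\<Sum>i\<in>UNIV. (x $ i)\<^sup>2) \<le> ?d * a\<^sup>2 + 2 * a * t + t\<^sup>2"
        using s1 s2 assms(2) by (intro add_mono mult_left_mono) auto
      then have "norm (real_vec (diag a + x)) \<le> r"
        using tQ unfolding Q_def in_ball mem_Collect_eq by (meson of_int_le_iff order_trans)
      moreover have "x \<in> {0..b}"
        using nn le le1 by (auto simp: less_eq_vec_def intro: order_trans)
      ultimately show "x \<in> {x \<in> {0..b}. norm (real_vec (diag a + x)) \<le> r}" by blast
    qed
  qed
qed

section \<open>Sparse sequences of prisms\<close>

text \<open>A single constant \<open>\<kappa>\<close> expresses comparability in both directions, as
  \<open>i\<close> and \<open>j\<close> may be exchanged. Having \<open>\<kappa> \<ge> 1\<close>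
  lets it absorb the \<open>+ 1\<close> in point counts.\<close>

locale sparse_prisms =
  fixes b :: "nat \<Rightarrow> int ^ 'd::finite" and a :: "nat \<Rightarrow> int" and \<kappa> C :: real
  assumes b_pos: "k \<ge> 1 \<Longrightarrow> b k $ i > 0"
    and \<kappa>: "\<kappa> \<ge> 1"
    and comparable: "k \<ge> 1 \<Longrightarrow> real_of_int (b k $ i) \<le> \<kappa> * real_of_int (b k $ j)"
    and lacunary: "(\<lambda>k. (\<Sum>i=1..k. prism_diameter (b i)) / prism_diameter (b (k + 1))) \<longlonglongrightarrow> 0"
    and a_nonneg: "k \<ge> 1 \<Longrightarrow> a k \<ge> 0"
    and separated: "k \<ge> 1 \<Longrightarrow> norm (real_vec (diag (a (k + 1)) :: int ^ 'd))
      > norm (real_vec (diag (a k) :: int ^ 'd)) + prism_diameter (b k)"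
    and C: "C > 0"
    and large: "k \<ge> 2 \<Longrightarrow>
      prism_diameter (b k) \<ge> C * norm (real_vec (diag (a (k - 1)) :: int ^ 'd))"
begin

section \<open>Geometry of corners and blocks\<close>

abbreviation l :: "nat \<Rightarrow> real" where
  "l k \<equiv> prism_diameter (b k)"

definition corner :: "nat \<Rightarrow> real" where
  "corner k = norm (real_vec (diag (a k) :: int ^ 'd))"

abbreviation block :: "nat \<Rightarrow> (int ^ 'd) set" where
  "block k \<equiv> (+) (diag (a k)) ` prism (b k)"

definition S :: "(int ^ 'd) set" where
  "S = (\<Union>k\<in>{1..}. block k)"

lemma b_nonneg: "k \<ge> 1 \<Longrightarrow> 0 \<le> b k"
  using b_pos by (auto simp: less_eq_vec_def intro: less_imp_le)

lemma side_le_l: "k \<ge> 1 \<Longrightarrow> b k $ i \<le> l k"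
  using component_le_norm_real_vec[of "b k" i] by (simp add: prism_diameter_eq b_nonneg)

lemma one_le_l: "k \<ge> 1 \<Longrightarrow> 1 \<le> l k"
  using side_le_l[of k undefined] b_pos[of k undefined] by linarith

lemma l_le_side:
  assumes "k \<ge> 1"
  shows "l k \<le> real CARD('d) * \<kappa> * real_of_int (b k $ i)"
proof -
  have "l k \<le> (\<Sum>j\<in>UNIV. \<bar>real_vec (b k) $ j\<bar>)"
    using assms norm_le_l1_cart[of "real_vec (b k)"] by (simp add: prism_diameter_eq b_nonneg)
  also have "\<dots> \<le> (\<Sum>j\<in>(UNIV :: 'd set). \<kappa> * real_of_int (b k $ i))"
    using comparable[OF assms] b_pos[OF assms] by (intro sum_mono) (simp add: real_vec_def less_imp_le)
  finally show ?thesis by (simp add: mult.assoc)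
qed

lemma dim_\<kappa>_ge_1: "real CARD('d) * \<kappa> \<ge> 1"
  using \<kappa> mult_mono[of 1 "real CARD('d)" 1 \<kappa>] by (simp add: Suc_le_eq)

lemma eventually_lacunary: "\<forall>\<^sub>F k in sequentially. (\<Sum>i=1..k. l i) \<le> l (k + 1)"
  using order_tendstoD(2)[OF lacunary, of 1]
proof (rule eventually_mono)
  fix k assume "(\<Sum>i=1..k. l i) / l (k + 1) < 1"
  then show "(\<Sum>i=1..k. l i) \<le> l (k + 1)"
    using one_le_l[of "k + 1"] by (simp add: divide_less_eq split: if_splits)
qed simp

lemma l_at_top: "filterlim l at_top sequentially"
proof -
  have "\<forall>\<^sub>F k in sequentially. real k \<le> l (k + 1)"
    using eventually_lacunary
  proof eventually_elim
    case (elim k)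
    have "real k = (\<Sum>i=1..k. 1)" by simp
    also have "\<dots> \<le> (\<Sum>i=1..k. l i)" using one_le_l by (intro sum_mono) auto
    finally show ?case using elim by simp
  qed
  then have "filterlim (\<lambda>k. l (k + 1)) at_top sequentially"
    by (rule filterlim_at_top_mono[OF filterlim_real_sequentially])
  then show ?thesis
    using filterlim_sequentially_Suc[of l] by simp
qed

lemma corner_nonneg [simp]: "0 \<le> corner k"
  by (simp add: corner_def)

lemma corner_Suc_gt: "k \<ge> 1 \<Longrightarrow> corner k + l k < corner (Suc k)"
  using separated[of k] by (simp add: corner_def)

lemma corner_mono:
  assumes "1 \<le> j" "j \<le> k"
  shows "corner j \<le> corner k"
  using assms(2)
proof (induction rule: dec_induct)
  case (step n)
  then show ?case using corner_Suc_gt[of n] one_le_l[of n] assms(1) by linarith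
qed simp

text \<open>A crude growth rate, enough to ensure that only finitely many corners lie in a ball, so
  that \<open>eventually_scale\<close> can take the last one.\<close>

lemma corner_ge:
  assumes "1 \<le> k"
  shows "real k - 1 \<le> corner k"
  using assms
proof (induction rule: dec_induct)
  case (step n)
  then show ?case using corner_Suc_gt[of n] one_le_l[of n] by simp
qed simp

lemma corner_eq:
  assumes "k \<ge> 1"
  shows "corner k = sqrt (real CARD('d)) * real_of_int (a k)"
proof -
  have "(corner k)\<^sup>2 = real CARD('d) * (real_of_int (a k))\<^sup>2"
    unfolding corner_def norm_real_vec_sq by (simp add: diag_def)
  then have "sqrt ((corner k)\<^sup>2) = sqrt (real CARD('d)) * \<bar>real_of_int (a k)\<bar>"
    by (simp only: real_sqrt_mult real_sqrt_abs)
  then show ?thesis using a_nonneg[OF assms] by simp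
qed

lemma a_le_corner: "k \<ge> 1 \<Longrightarrow> a k \<le> corner k"
  using component_le_norm_real_vec[of "diag (a k) :: int ^ 'd" undefined]
  by (simp add: corner_def diag_def)

lemma a_mono:
  assumes "1 \<le> j" "j \<le> k"
  shows "a j \<le> a k"
  using corner_mono[OF assms] assms by (simp add: corner_eq)

lemma C_a_le_l:
  assumes "k \<ge> 2"
  shows "C * real_of_int (a (k - 1)) \<le> l k"
proof -
  have "C * real_of_int (a (k - 1)) \<le> C * corner (k - 1)"
    using a_le_corner[of "k - 1"] C assms by (intro mult_left_mono) auto
  then show ?thesis using large[OF assms] by (simp add: corner_def)
qed

lemma finite_block [simp]: "finite (block k)"
  by (simp add: prism_eq_interval)

lemma card_block: "card (block k) = card {0..b k}"
  by (simp add: prism_eq_interval card_image)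

lemma norm_block_le:
  assumes "1 \<le> k" "n \<in> block k"
  shows "norm (real_vec n) \<le> corner k + l k"
proof -
  obtain x where x: "x \<in> {0..b k}" "n = diag (a k) + x"
    using assms(2) by (auto simp: prism_eq_interval)
  have "real_vec n = real_vec (diag (a k)) + real_vec x"
    by (simp add: x real_vec_def vec_eq_iff)
  then have "norm (real_vec n) \<le> corner k + norm (real_vec x)"
    by (simp add: corner_def norm_triangle_ineq)
  also have "norm (real_vec x) \<le> l k"
    using x(1) assms(1) by (simp add: prism_diameter_eq b_nonneg norm_real_vec_mono)
  finally show ?thesis by simp
qed

lemma norm_block_ge:
  assumes "1 \<le> k" "n \<in> block k"
  shows "corner k \<le> norm (real_vec n)"
  using assms a_nonneg[OF assms(1)]
  unfolding corner_def by (intro norm_real_vec_mono) (auto simp: prism_eq_interval less_eq_vec_def diag_def)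

text \<open>By separation each block ends before the sphere through the next corner, and nonnegative
  coordinates keep it outside the open ball through its own corner. So only block \<open>k\<close>
  can be cut.\<close>

lemma S_Int_ball:
  assumes "1 \<le> k" "corner k \<le> r" "r < corner (Suc k)"
  shows "S \<inter> lattice_ball r = (\<Union>j\<in>{1..<k}. block j) \<union> (block k \<inter> lattice_ball r)"
proof (intro equalityI subsetI)
  fix n assume n: "n \<in> S \<inter> lattice_ball r"
  then obtain j where j: "1 \<le> j" "n \<in> block j" "norm (real_vec n) \<le> r"
    by (auto simp: S_def lattice_ball_def)
  have "\<not> Suc k \<le> j"
    using norm_block_ge[OF j(1,2)] corner_mono[of "Suc k" j] assms(1,3) j(3) by force
  then show "n \<in> (\<Union>j\<in>{1..<k}. block j) \<union> (block k \<inter> lattice_ball r)"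
    using j n by (cases "j = k") auto
next
  fix n assume "n \<in> (\<Union>j\<in>{1..<k}. block j) \<union> (block k \<inter> lattice_ball r)"
  then consider j where "1 \<le> j" "j < k" "n \<in> block j" | "n \<in> block k \<inter> lattice_ball r" by auto
  then show "n \<in> S \<inter> lattice_ball r"
  proof cases
    case 1
    have "norm (real_vec n) \<le> corner (Suc j)"
      using norm_block_le[OF 1(1,3)] corner_Suc_gt[OF 1(1)] by linarith
    also have "\<dots> \<le> r" using corner_mono[of "Suc j" k] 1 assms(2) by simp
    finally show ?thesis using 1 by (auto simp: S_def lattice_ball_def)
  next
    case 2
    then show ?thesis using assms(1) by (auto simp: S_def)
  qed
qed

lemma eventually_scale:
  "\<forall>\<^sub>F r in at_top. \<exists>k\<ge>K. 1 \<le> k \<and> corner k \<le> r \<and> r < corner (Suc k)"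
  using eventually_ge_at_top[of "corner (max 1 K)"]
proof eventually_elim
  case (elim r)
  let ?Z = "{k. 1 \<le> k \<and> corner k \<le> r}"
  have "?Z \<subseteq> {..nat \<lceil>r\<rceil> + 1}"
  proof clarify
    fix k assume "1 \<le> k" "corner k \<le> r"
    then have "real k - 1 \<le> r" using corner_ge[of k] by linarith
    then show "k \<le> nat \<lceil>r\<rceil> + 1" by linarith
  qed
  then have fin: "finite ?Z" using finite_subset by blast
  have mem: "max 1 K \<in> ?Z" using elim by simp
  define k where "k = Max ?Z"
  have "k \<in> ?Z" unfolding k_def using fin mem Max_in by blast
  moreover have "max 1 K \<le> k" unfolding k_def using fin mem by (rule Max_ge)
  moreover have "Suc k \<notin> ?Z"
  proof
    assume "Suc k \<in> ?Z"
    from Max_ge[OF fin this] show False by (simp only: k_def[symmetric])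
  qed
  ultimately show ?case by auto
qed

text \<open>The cubes used in \<open>average_set_covered\<close>. Without the lower bound on
  \<open>s\<close> at the corners, every cone section would contain infinitely many of them.\<close>

definition family :: "((int ^ 'd) \<times> nat) set" where
  "family = range (\<lambda>s. (0, s)) \<union> {(diag (a k), s) | k s. 2 \<le> k \<and> l (k - 1) \<le> real s}"

lemma cone_condition_family: "\<exists>A\<ge>0. cone_condition family A"
proof -
  define R where "R = nat \<lceil>1 / C\<rceil>"
  let ?A = "(2 + real R) ^ CARD('d) + 2 * 2 ^ CARD('d)"
  have "finite (cone_section family \<sigma>) \<and>
     real (card (cone_section family \<sigma>)) \<le> ?A * (real \<sigma> + 1) ^ CARD('d)" for \<sigma>
  proof -
    let ?D = "\<lambda>z. ({diag (z - int \<sigma>)..diag (z + int \<sigma>)} :: (int ^ 'd) set)"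
    let ?O = "{diag (- int \<sigma>)..diag (int R * int \<sigma> + int \<sigma>)} :: (int ^ 'd) set"
    define Z where "Z = {k. 2 \<le> k \<and> l (k - 1) \<le> real \<sigma> \<and> int R * int \<sigma> < a k}"
    obtain p where p: "Z \<subseteq> {p, Suc p}"
    proof (cases "Z = {}")
      case False
      define p where "p = (LEAST k. k \<in> Z)"
      have pZ: "p \<in> Z" using False unfolding p_def by (metis LeastI ex_in_conv)
      have "k = p \<or> k = Suc p" if "k \<in> Z" for k
      proof (rule ccontr)
        assume neq: "\<not> (k = p \<or> k = Suc p)"
        have "p \<le> k" unfolding p_def using that by (rule Least_le)
        then have k: "p + 2 \<le> k" using neq by simp
        have p2: "2 \<le> p" using pZ by (simp add: Z_def)
        have "a p \<le> a (k - 2)" using k p2 by (intro a_mono) auto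
        then have "int R * int \<sigma> < a (k - 2)" using pZ by (simp add: Z_def)
        then have "real R * real \<sigma> < real_of_int (a (k - 2))"
          by (metis of_int_less_iff of_int_mult of_int_of_nat_eq)
        moreover have "1 / C \<le> real R" by (simp add: R_def real_nat_ceiling_ge)
        then have "1 / C * real \<sigma> \<le> real R * real \<sigma>" by (intro mult_right_mono) auto
        ultimately have "1 / C * real \<sigma> < real_of_int (a (k - 2))" by linarith
        then have "real \<sigma> < C * real_of_int (a (k - 2))" using C by (simp add: field_simps)
        also have "\<dots> \<le> l (k - 1)" using C_a_le_l[of "k - 1"] k p2 by (simp add: numeral_2_eq_2)
        also have "\<dots> \<le> real \<sigma>" using that by (simp add: Z_def)
        finally show False by simp
      qed
      then show thesis using that[of p] by blast
    qed blast
    have "cone_section family \<sigma> \<subseteq> ?O \<union> (?D (a p) \<union> ?D (a (Suc p)))"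
    proof
      fix x assume "x \<in> cone_section family \<sigma>"
      then obtain z s where zs: "(z, s) \<in> family" "s \<le> \<sigma>"
        "x \<in> {z - diag (int \<sigma>)..z + diag (int \<sigma>)}"
        by (auto simp: cone_section_def)
      consider "z = 0" | k where "z = diag (a k)" "2 \<le> k" "l (k - 1) \<le> real s"
        using zs(1) by (auto simp: family_def)
      then show "x \<in> ?O \<union> (?D (a p) \<union> ?D (a (Suc p)))"
      proof cases
        case 1
        have "x \<in> ?O"
          using zs(3) by (auto simp: 1 less_eq_vec_def diag_def intro: order_trans)
        then show ?thesis by blast
      next
        case (2 k)
        show ?thesis
        proof (cases "k \<in> Z")
          case True
          then show ?thesis
            using p zs(3) by (auto simp: 2(1) less_eq_vec_def diag_def)
        next
          case False
          then have "a k \<le> int R * int \<sigma>"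
            using 2 zs(2) by (auto simp: Z_def)
          moreover have "0 \<le> a k" using a_nonneg 2(2) by simp
          ultimately have "x \<in> ?O"
            using zs(3) unfolding 2(1) atLeastAtMost_iff less_eq_vec_def by (simp add: diag_def) (smt (verit))
          then show ?thesis by blast
        qed
      qed
    qed
    moreover have fin: "finite (?O \<union> (?D (a p) \<union> ?D (a (Suc p))))" by simp
    ultimately have "card (cone_section family \<sigma>) \<le> card (?O \<union> (?D (a p) \<union> ?D (a (Suc p))))"
      by (intro card_mono) auto
    also have "\<dots> \<le> card ?O + (card (?D (a p)) + card (?D (a (Suc p))))"
      by (meson add_left_mono card_Un_le order_trans)
    finally have card_le: "real (card (cone_section family \<sigma>))
        \<le> real (card ?O) + (real (card (?D (a p))) + real (card (?D (a (Suc p)))))"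
      by (simp flip: of_nat_add)
    have card_O: "real (card ?O) \<le> ((2 + real R) * (real \<sigma> + 1)) ^ CARD('d)"
      by (subst card_interval_diag) (auto simp: algebra_simps intro!: power_mono)
    have card_D: "real (card (?D z)) \<le> (2 * (real \<sigma> + 1)) ^ CARD('d)" for z
      by (subst card_interval_diag) (auto simp: algebra_simps intro!: power_mono)
    have "real (card (cone_section family \<sigma>)) \<le> ?A * (real \<sigma> + 1) ^ CARD('d)"
      unfolding distrib_right
      using card_le card_O[unfolded power_mult_distrib] card_D[of "a p", unfolded power_mult_distrib]
        card_D[of "a (Suc p)", unfolded power_mult_distrib] by linarith
    then show ?thesis
      using finite_subset[OF \<open>cone_section family \<sigma> \<subseteq> _\<close> fin] by blast
  qed
  then show ?thesis
    by (intro exI[of _ ?A]) (auto simp: cone_condition_def)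
qed

section \<open>Covering the averaged sets by three cubes\<close>

lemma card_piece_ge:
  fixes m :: "int ^ 'd"
  assumes "0 \<le> m" "0 \<le> y" "\<And>i. y \<le> K * (real_of_int (m $ i) + 1)" "K \<ge> 0"
    and P: "{0..\<chi> i. m $ i div int CARD('d)} \<subseteq> P" "finite P"
  shows "y ^ CARD('d) \<le> (K * CARD('d)) ^ CARD('d) * card P"
proof -
  let ?q = "\<chi> i. m $ i div int CARD('d) :: int ^ 'd"
  have q: "0 \<le> ?q"
    using assms(1) by (simp add: less_eq_vec_def pos_imp_zdiv_nonneg_iff)
  have "y \<le> K * CARD('d) * (real_of_int (?q $ i) + 1)" for i
  proof -
    let ?d = "int CARD('d)"
    have d: "0 < ?d" by simp
    \<comment> \<open>The remainder modulo d is at most d - 1, so rounding down costs at most a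
      factor d in the number of points per side.\<close>
    have "m $ i + 1 \<le> ?d * (m $ i div ?d + 1)"
      using mult_div_mod_eq[of ?d "m $ i"] pos_mod_bound[OF d, of "m $ i"]
      unfolding distrib_left mult_1_right by linarith
    then have "real_of_int (m $ i + 1) \<le> real_of_int (?d * (m $ i div ?d + 1))"
      by (rule of_int_le_iff[THEN iffD2])
    then have "real_of_int (m $ i) + 1 \<le> CARD('d) * (real_of_int (?q $ i) + 1)"
      by simp
    then have "K * (real_of_int (m $ i) + 1) \<le> K * (CARD('d) * (real_of_int (?q $ i) + 1))"
      using \<open>K \<ge> 0\<close> by (rule mult_left_mono)
    then show ?thesis using assms(3)[of i] by (simp only: mult.assoc)
  qed
  from power_le_card_interval[OF q assms(2) this]
  have "y ^ CARD('d) \<le> (K * CARD('d)) ^ CARD('d) * card {0..?q}" .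
  also have "\<dots> \<le> (K * CARD('d)) ^ CARD('d) * card P"
    using assms(4) P by (intro mult_left_mono) (auto simp: card_mono)
  finally show ?thesis .
qed

text \<open>Truncating all sides at the same \<open>t\<close> preserves their comparability since
  \<open>\<kappa> \<ge> 1\<close>, and the piece is a down-set because the norm is monotone on
  nonnegative vectors.\<close>

lemma last_piece:
  assumes k: "1 \<le> k" and r: "corner k \<le> r"
  obtains m :: "int ^ 'd" and P where "0 \<le> m"
    "block k \<inter> lattice_ball r = (+) (diag (a k)) ` P"
    "P \<subseteq> {0..m}" "{0..\<chi> i. m $ i div int CARD('d)} \<subseteq> P" "finite P"
    "\<And>i j. real_of_int (m $ i) \<le> \<kappa> * real_of_int (m $ j)"
    "\<And>x y. x \<in> P \<Longrightarrow> y \<in> {0..x} \<Longrightarrow> y \<in> P"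
proof -
  let ?P = "{x \<in> {0..b k}. norm (real_vec (diag (a k) + x)) \<le> r}"
  obtain t :: int where t: "0 \<le> t" "?P \<subseteq> {0..\<chi> i. min t (b k $ i)}"
    "{0..\<chi> i. min t (b k $ i) div int CARD('d)} \<subseteq> ?P"
    using ball_corner_sandwich[OF b_nonneg[OF k] a_nonneg[OF k] r[unfolded corner_def]] by blast
  have finP: "finite ?P" using finite_subset[OF t(2)] by simp
  show thesis
  proof (rule that[OF _ _ t(2) _ finP])
    show "0 \<le> (\<chi> i. min t (b k $ i))"
      using t(1) b_nonneg[OF k] by (simp add: less_eq_vec_def)
    show "block k \<inter> lattice_ball r = (+) (diag (a k)) ` ?P"
      by (auto simp: prism_eq_interval lattice_ball_def)
    show "{0..\<chi> i. (\<chi> i. min t (b k $ i)) $ i div int CARD('d)} \<subseteq> ?P"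
      using t(3) by simp
    show "real_of_int ((\<chi> i. min t (b k $ i)) $ i) \<le> \<kappa> * real_of_int ((\<chi> i. min t (b k $ i)) $ j)" for i j
    proof (cases "t \<le> b k $ j")
      case True
      have "real_of_int t \<le> \<kappa> * real_of_int t" using t(1) \<kappa> by (simp add: mult_le_cancel_right1)
      then show ?thesis using True by (simp add: min_def)
    next
      case False
      then show ?thesis using comparable[OF k, of i j] by (auto simp: min_def)
    qed
    show "y \<in> ?P" if x: "x \<in> ?P" and y: "y \<in> {0..x}" for x y
    proof -
      have "norm (real_vec (diag (a k) + y)) \<le> norm (real_vec (diag (a k) + x))"
        using y a_nonneg[OF k] by (intro norm_real_vec_mono) (auto simp: less_eq_vec_def diag_def)
      then show ?thesis using x y by (auto intro: order_trans)
    qed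
  qed
qed

lemma average_set_card_ge:
  assumes "2 \<le> k" "corner k \<le> r" "r < corner (Suc k)"
  shows "card (block (k - 1)) \<le> card (S \<inter> lattice_ball r)"
    "card (block k \<inter> lattice_ball r) \<le> card (S \<inter> lattice_ball r)"
proof -
  have eq: "S \<inter> lattice_ball r = (\<Union>j\<in>{1..<k}. block j) \<union> (block k \<inter> lattice_ball r)"
    using assms by (intro S_Int_ball) auto
  have fin: "finite (S \<inter> lattice_ball r)" unfolding eq by auto
  have "block (k - 1) \<subseteq> S \<inter> lattice_ball r"
    unfolding eq using assms(1) by (intro le_supI1 UN_upper) auto
  then show "card (block (k - 1)) \<le> card (S \<inter> lattice_ball r)"
    using fin card_mono by blast
  show "card (block k \<inter> lattice_ball r) \<le> card (S \<inter> lattice_ball r)"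
    unfolding eq by (rule card_mono) (use fin eq in auto)
qed

lemma power_le_card_block:
  assumes "1 \<le> k" "0 \<le> K"
  shows "(K * l k) ^ CARD('d) \<le> (K * (CARD('d) * \<kappa>)) ^ CARD('d) * card (block k)"
  unfolding card_block
proof (rule power_le_card_interval[OF b_nonneg[OF assms(1)]])
  show "0 \<le> K * l k" using one_le_l[OF assms(1)] assms(2) by simp
  fix i
  have "l k \<le> real CARD('d) * \<kappa> * (real_of_int (b k $ i) + 1)"
    using l_le_side[OF assms(1), of i] dim_\<kappa>_ge_1 by (simp add: distrib_left)
  then show "K * l k \<le> K * (real CARD('d) * \<kappa>) * (real_of_int (b k $ i) + 1)"
    using assms(2) by (simp add: mult.assoc mult_left_mono)
qed

text \<open>The cube at the origin holds all blocks before \<open>k - 1\<close>; the others sit at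
  corners \<open>k - 1\<close> and \<open>k\<close>. The first two have side comparable to
  \<open>l (k - 1)\<close> and are paid for by block \<open>k - 1\<close>. The third is paid for by
  that block or by the cut piece, whichever determines its side.\<close>

lemma average_set_covered:
  "\<exists>D::real. 0 < D \<and> (\<forall>\<^sub>F r in at_top. \<exists>G\<subseteq>family. finite G \<and> card G \<le> 3 \<and>
    S \<inter> lattice_ball r \<subseteq> (\<Union>(z, s)\<in>G. (+) z ` cube s) \<and>
    (\<forall>(z, s)\<in>G. (real s + 1) ^ CARD('d) \<le> D * card (S \<inter> lattice_ball r)))"
proof -
  let ?d = "CARD('d)"
  \<comment> \<open>Coordinates of blocks before \<open>k - 1\<close> are at most a_{k-2} + l_{k-1}
    \<le> (1/C + 1) l_{k-1}. The remaining 2 covers rounding up and the \<open>+ 1\<close> of the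
    point count, each at most l_{k-1}.\<close>
  let ?K = "1 / C + 3"
  define D1 where "D1 = (?K * (?d * \<kappa>)) ^ ?d"
  \<comment> \<open>One \<open>\<kappa>\<close> makes the reference side \<open>i0\<close> dominate
    all sides, the other compares \<open>i0\<close> back with an arbitrary side. The 2 absorbs
    rounding and the \<open>+ 1\<close>; the d is the loss in \<open>card_piece_ge\<close>.\<close>
  define D2 where "D2 = (2 * \<kappa> * \<kappa> * ?d) ^ ?d"
  have "?K \<ge> 3" using C by simp
  then have "D1 > 0" "D2 > 0"
    using \<kappa> C unfolding D1_def D2_def by (auto intro!: zero_less_power mult_pos_pos add_pos_pos)
  have "\<forall>\<^sub>F k in sequentially. (\<Sum>i=1..k. l i) \<le> l (Suc k)"
    using eventually_lacunary by simp
  then obtain K0 where K0: "\<And>k. k \<ge> K0 \<Longrightarrow> (\<Sum>i=1..k. l i) \<le> l (Suc k)"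
    by (auto simp: eventually_sequentially)
  have l_le: "l j \<le> l (Suc k)" if "k \<ge> K0" "1 \<le> j" "j \<le> k" for j k
  proof -
    have "l j \<le> (\<Sum>i=1..k. l i)"
      using that one_le_l by (intro member_le_sum) (auto intro: order_trans[OF zero_le_one])
    then show ?thesis using K0[OF that(1)] by simp
  qed
  have main: "\<exists>G\<subseteq>family. finite G \<and> card G \<le> 3 \<and>
    S \<inter> lattice_ball r \<subseteq> (\<Union>(z, s)\<in>G. (+) z ` cube s) \<and>
    (\<forall>(z, s)\<in>G. (real s + 1) ^ ?d \<le> (D1 + D2) * card (S \<inter> lattice_ball r))"
    if k: "k \<ge> K0 + 3" "corner k \<le> r" "r < corner (Suc k)" for k r
  proof -
    let ?N = "real (card (S \<inter> lattice_ball r))" and ?l = "l (k - 1)"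
    have l1: "1 \<le> ?l" using k by (intro one_le_l) auto
    have l_prev: "l j \<le> ?l" if "1 \<le> j" "j \<le> k - 2" for j
    proof -
      have "Suc (k - 2) = k - 1" using k(1) by simp
      then show ?thesis using l_le[of "k - 2" j] that k(1) by auto
    qed
    note N = average_set_card_ge[of k r]
    have small: "(real s + 1) ^ ?d \<le> D1 * ?N" if "real s + 1 \<le> ?K * ?l" for s
    proof -
      have "(real s + 1) ^ ?d \<le> (?K * ?l) ^ ?d"
        using that by (intro power_mono) auto
      also have "\<dots> \<le> D1 * card (block (k - 1))"
        unfolding D1_def using k C by (intro power_le_card_block) auto
      also have "\<dots> \<le> D1 * ?N"
        using N k \<open>D1 > 0\<close> by (intro mult_left_mono) auto
      finally show ?thesis .
    qed
    have k1: "1 \<le> k" using k by simp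
    obtain m P where m: "0 \<le> m"
      "block k \<inter> lattice_ball r = (+) (diag (a k)) ` P"
      "P \<subseteq> {0..m}" "{0..\<chi> i. m $ i div int CARD('d)} \<subseteq> P" "finite P"
      "\<And>i j. real_of_int (m $ i) \<le> \<kappa> * real_of_int (m $ j)"
      "\<And>x y. x \<in> P \<Longrightarrow> y \<in> {0..x} \<Longrightarrow> y \<in> P"
      by (rule last_piece[OF k1 k(2)]) (rule that)
    have cardP: "card P \<le> ?N"
      using N(2) k m(2) by (simp add: card_image)
    define i0 :: 'd where "i0 = undefined"
    have m0: "0 \<le> m $ i" for i using m(1) by (simp add: less_eq_vec_def)
    define s0 where "s0 = nat \<lceil>(1 / C + 1) * ?l\<rceil>"
    define s1 where "s1 = nat \<lceil>?l\<rceil>"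
    define s2 where "s2 = nat \<lceil>\<kappa> * m $ i0\<rceil>"
    have s0: "(1 / C + 1) * ?l \<le> real s0" "real s0 + 1 \<le> ?K * ?l"
    proof -
      show "(1 / C + 1) * ?l \<le> real s0" by (simp add: s0_def real_nat_ceiling_ge)
      have "(1 / C + 1) * ?l \<ge> 0" using C l1 by simp
      then have "real s0 \<le> (1 / C + 1) * ?l + 1"
        unfolding s0_def using of_int_ceiling_le_add_one[of "(1 / C + 1) * ?l"] by simp
      then show "real s0 + 1 \<le> ?K * ?l" using l1 by (simp add: algebra_simps)
    qed
    have s1: "?l \<le> real s1" "real s1 + 1 \<le> ?K * ?l"
    proof -
      show "?l \<le> real s1" by (simp add: s1_def real_nat_ceiling_ge)
      have "real s1 \<le> ?l + 1"
        unfolding s1_def using of_int_ceiling_le_add_one[of ?l] l1 by simp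
      moreover have "3 * ?l \<le> ?K * ?l" using l1 C by (intro mult_right_mono) auto
      ultimately show "real s1 + 1 \<le> ?K * ?l" using l1 by linarith
    qed
    have s2: "\<And>i. m $ i \<le> int s2" "(real s2 + 1) ^ ?d \<le> D2 * ?N"
    proof -
      have "real_of_int (m $ i) \<le> real s2" for i
        using m(6)[of i i0] real_nat_ceiling_ge[of "\<kappa> * m $ i0"] by (simp add: s2_def)
      then show "m $ i \<le> int s2" for i
        by (metis of_int_le_iff of_int_of_nat_eq)
      have "0 \<le> \<kappa> * m $ i0" using \<kappa> m0[of i0] by simp
      then have "real s2 = real_of_int \<lceil>\<kappa> * m $ i0\<rceil>"
        by (simp add: s2_def)
      then have "real s2 + 1 \<le> \<kappa> * m $ i0 + 2"
        by linarith
      also have "\<dots> \<le> 2 * \<kappa> * \<kappa> * (m $ i + 1)" for i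
      proof -
        have "\<kappa> * m $ i0 \<le> \<kappa> * (\<kappa> * m $ i)" using m(6)[of i0 i] \<kappa> by (intro mult_left_mono) auto
        moreover have "1 * 1 \<le> \<kappa> * \<kappa>" using \<kappa> by (intro mult_mono) auto
        moreover have "0 \<le> \<kappa> * (\<kappa> * m $ i)" using \<kappa> m0[of i] by simp
        ultimately show ?thesis by (simp add: algebra_simps)
      qed
      finally have "real s2 + 1 \<le> 2 * \<kappa> * \<kappa> * (m $ i + 1)" for i .
      then have "(real s2 + 1) ^ ?d \<le> D2 * card P"
        unfolding D2_def using m(1) \<kappa> by (intro card_piece_ge[OF m(1) _ _ _ m(4,5)]) auto
      also have "\<dots> \<le> D2 * ?N" using cardP \<open>D2 > 0\<close> by (intro mult_left_mono) auto
      finally show "(real s2 + 1) ^ ?d \<le> D2 * ?N" .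
    qed
    \<comment> \<open>The side is raised to at least \<open>l (k - 1)\<close>, as membership in
      \<open>family\<close> requires.\<close>
    define s3 where "s3 = max s1 s2"
    have s3: "(real s3 + 1) ^ ?d \<le> (D1 + D2) * ?N"
      using small[OF s1(2)] s2(2) \<open>D1 > 0\<close> \<open>D2 > 0\<close>
      by (simp add: s3_def max_def distrib_right add_increasing add_increasing2)
    let ?G = "{(0, s0), (diag (a (k - 1)), s1), (diag (a k), s3)} :: ((int ^ 'd) \<times> nat) set"
    have "?G \<subseteq> family"
    proof -
      have "l (k - 1 - 1) \<le> real s1"
        using order_trans[OF l_prev s1(1), of "k - 1 - 1"] k by auto
      then show ?thesis
        using k s1(1) by (auto simp: family_def s3_def intro: order_trans)
    qed
    moreover have "card ?G \<le> 3" by (simp add: card_insert_if)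
    moreover have "S \<inter> lattice_ball r \<subseteq> (\<Union>(z, s)\<in>?G. (+) z ` cube s)"
    proof
      fix n assume "n \<in> S \<inter> lattice_ball r"
      then have "n \<in> (\<Union>j\<in>{1..<k}. block j) \<union> (block k \<inter> lattice_ball r)"
        using S_Int_ball[of k r] k by simp
      then consider j where "1 \<le> j" "j < k - 1" "n \<in> block j" | "n \<in> block (k - 1)"
        | "n \<in> block k \<inter> lattice_ball r"
      proof (elim UnE UN_E)
        fix j assume j: "j \<in> {1..<k}" "n \<in> block j"
        then have "1 \<le> j" "j < k - 1 \<or> j = k - 1" by auto
        then show thesis using that(1,2) j(2) by blast
      qed (use that(3) in blast)
      then show "n \<in> (\<Union>(z, s)\<in>?G. (+) z ` cube s)"
      proof cases
        case 1
        then obtain x where x: "x \<in> {0..b j}" "n = diag (a j) + x"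
          by (auto simp: prism_eq_interval)
        have "n $ i \<le> int s0" for i
        proof -
          have "a j \<le> a (k - 2)" using 1 k by (intro a_mono) auto
          moreover have "C * a (k - 2) \<le> ?l" using C_a_le_l[of "k - 1"] k by (simp add: numeral_2_eq_2)
          then have "a (k - 2) \<le> 1 / C * ?l" using C by (simp add: field_simps)
          moreover have "real_of_int (x $ i) \<le> l j"
            using x(1) side_le_l[OF 1(1), of i] by (auto simp: less_eq_vec_def) (meson of_int_le_iff order_trans)
          moreover have "l j \<le> ?l" using 1 by (intro l_prev) auto
          ultimately have "real_of_int (a j) + x $ i \<le> real s0"
            using s0(1) by (simp add: distrib_right)
          then show ?thesis by (simp add: x(2) diag_def flip: of_int_add)
        qed
        moreover have "0 \<le> n $ i" for i
          using x(1) a_nonneg[OF 1(1)] by (simp add: x(2) diag_def less_eq_vec_def)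
        ultimately have "n \<in> (+) 0 ` cube s0"
          by (simp add: cube_def less_eq_vec_def diag_def)
        then show ?thesis by blast
      next
        case 2
        have "b (k - 1) $ i \<le> int s1" for i
        proof -
          have "1 \<le> k - 1" using k(1) by simp
          from order_trans[OF side_le_l[OF this, of i] s1(1)] show ?thesis by linarith
        qed
        then have "prism (b (k - 1)) \<subseteq> cube s1"
          by (auto simp: prism_def cube_def less_eq_vec_def diag_def) (meson order_trans)
        then show ?thesis using 2 by blast
      next
        case 3
        have "m $ i \<le> int s3" for i using s2(1)[of i] by (simp add: s3_def)
        then have "P \<subseteq> cube s3"
          using m(3) by (auto simp: subset_iff cube_def less_eq_vec_def diag_def) (meson order_trans)
        moreover have "n \<in> (+) (diag (a k)) ` P" using 3 unfolding m(2) .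
        ultimately have "n \<in> (+) (diag (a k)) ` cube s3" by (meson image_mono subsetD)
        then show ?thesis by simp
      qed
    qed
    moreover have "\<forall>(z, s)\<in>?G. (real s + 1) ^ ?d \<le> (D1 + D2) * ?N"
      using small[OF s0(2)] small[OF s1(2)] s3 \<open>D2 > 0\<close>
      by (auto simp: distrib_right add_increasing2)
    ultimately show ?thesis by (intro exI[of _ ?G]) auto
  qed
  have "\<forall>\<^sub>F r in at_top. \<exists>G\<subseteq>family. finite G \<and> card G \<le> 3 \<and>
    S \<inter> lattice_ball r \<subseteq> (\<Union>(z, s)\<in>G. (+) z ` cube s) \<and>
    (\<forall>(z, s)\<in>G. (real s + 1) ^ ?d \<le> (D1 + D2) * card (S \<inter> lattice_ball r))"
    by (rule eventually_mono[OF eventually_scale[of "K0 + 3"]]) (elim exE conjE, rule main)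
  then show ?thesis
    using \<open>D1 > 0\<close> \<open>D2 > 0\<close> by (intro exI[of _ "D1 + D2"]) auto
qed

end

section \<open>Asymptotic invariance of the averaged sets\<close>

lemma finite_lattice_ball [simp]: "finite (lattice_ball r :: (int ^ 'd::finite) set)"
proof (rule finite_subset)
  show "lattice_ball r \<subseteq> {diag (- \<lceil>r\<rceil>)..diag \<lceil>r\<rceil> :: int ^ 'd}"
  proof
    fix n :: "int ^ 'd" assume "n \<in> lattice_ball r"
    then have "\<bar>real_of_int (n $ i)\<bar> \<le> r" for i
      using component_le_norm_real_vec[of n i] by (simp add: lattice_ball_def)
    then have "- \<lceil>r\<rceil> \<le> n $ i \<and> n $ i \<le> \<lceil>r\<rceil>" for i
      by (smt (verit) le_of_int_ceiling of_int_le_iff of_int_minus)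
    then show "n \<in> {diag (- \<lceil>r\<rceil>)..diag \<lceil>r\<rceil>}"
      by (simp add: less_eq_vec_def diag_def)
  qed
qed simp

text \<open>Converts the total volume of the early blocks into a power of the sum of their
  diameters, the quantity that lacunarity controls.\<close>

lemma sum_power_le_power_sum:
  fixes x :: "'i \<Rightarrow> real"
  assumes "finite I" "\<And>i. i \<in> I \<Longrightarrow> 0 \<le> x i" "n > 0"
  shows "(\<Sum>i\<in>I. x i ^ n) \<le> (\<Sum>i\<in>I. x i) ^ n"
proof -
  obtain k where n: "n = Suc k" using assms(3) gr0_implies_Suc by blast
  have "(\<Sum>i\<in>I. x i ^ n) \<le> (\<Sum>i\<in>I. x i * (\<Sum>i\<in>I. x i) ^ k)"
    unfolding n power_Suc using assms(1,2)
    by (intro sum_mono mult_left_mono power_mono member_le_sum) auto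
  then show ?thesis by (simp add: n sum_distrib_right)
qed

lemma escape_UN_le:
  assumes "finite I" "\<And>i. i \<in> I \<Longrightarrow> finite (A i)"
  shows "escape v (\<Union>i\<in>I. A i) \<le> (\<Sum>i\<in>I. escape v (A i))"
  using assms
proof (induction I)
  case (insert i I)
  have "escape v (\<Union>j\<in>insert i I. A j) \<le> escape v (A i) + escape v (\<Union>j\<in>I. A j)"
    using escape_Un_le[of "A i" "\<Union>j\<in>I. A j" v] insert.prems insert.hyps(1) by simp
  then show ?case using insert by fastforce
qed (simp add: escape_def)

context sparse_prisms
begin

text \<open>Here \<open>L\<close> is the diameter of the previous block. A piece with side at least
  sqrt L loses only a fraction of order 1/sqrt L of its points. A shorter one has at most (\<kappa>
  sqrt L)^d points altogether, negligible against L^d, which is at most a constant times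
  \<open>N\<close>.\<close>

lemma escape_last_piece:
  assumes "1 \<le> k" "corner k \<le> r" "L > 0"
    and N: "card (block k \<inter> lattice_ball r) \<le> N" "L ^ CARD('d) \<le> (CARD('d) * \<kappa>) ^ CARD('d) * N"
  shows "escape (axis i 1) (block k \<inter> lattice_ball r)
    \<le> ((\<kappa> * \<kappa> * CARD('d)) ^ CARD('d) / sqrt L + (\<kappa> * \<kappa> * CARD('d) / sqrt L) ^ CARD('d)) * N"
proof -
  let ?d = "CARD('d)"
  obtain m P where m: "0 \<le> m"
    "block k \<inter> lattice_ball r = (+) (diag (a k)) ` P"
    "P \<subseteq> {0..m}" "{0..\<chi> i. m $ i div int CARD('d)} \<subseteq> P" "finite P"
    "\<And>i j. real_of_int (m $ i) \<le> \<kappa> * real_of_int (m $ j)"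
    "\<And>x y. x \<in> P \<Longrightarrow> y \<in> {0..x} \<Longrightarrow> y \<in> P"
    by (rule last_piece[OF assms(1,2)]) (rule that)
  define q where "q = real_of_int (m $ i) + 1"
  have m0: "0 \<le> real_of_int (m $ j)" for j using m(1) by (simp add: less_eq_vec_def)
  have q1: "1 \<le> q" using m0[of i] by (simp add: q_def)
  have N0: "0 \<le> N" using N(1) of_nat_0_le_iff order_trans by blast
  have "real_of_int (m $ j) + 1 \<le> \<kappa> * q" for j
    using m(6)[of j i] \<kappa> by (simp add: q_def distrib_left)
  then have box_le: "card {0..m} \<le> (\<kappa> * q) ^ ?d"
    by (rule card_interval_le_power[OF m(1)])
  have "\<kappa> * q \<le> \<kappa> * \<kappa> * (real_of_int (m $ j) + 1)" for j
  proof -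
    have "q \<le> \<kappa> * (real_of_int (m $ j) + 1)"
      using m(6)[of i j] \<kappa> by (simp add: q_def distrib_left)
    then show ?thesis using \<kappa> by (simp add: mult.assoc mult_left_mono)
  qed
  then have "(\<kappa> * q) ^ ?d \<le> (\<kappa> * \<kappa> * ?d) ^ ?d * card P"
    using \<kappa> q1 by (intro card_piece_ge[OF m(1) _ _ _ m(4,5)]) auto
  also have "\<dots> \<le> (\<kappa> * \<kappa> * ?d) ^ ?d * N"
    using N(1) \<kappa> m(2) by (intro mult_left_mono) (auto simp: card_image)
  finally have box_le_N: "(\<kappa> * q) ^ ?d \<le> (\<kappa> * \<kappa> * ?d) ^ ?d * N" .
  have esc: "escape (axis i 1) P * q \<le> card {0..m}"
    unfolding q_def using m(3,7,1) by (rule escape_downset)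
  have sL: "sqrt L > 0" using \<open>L > 0\<close> by simp
  have "escape (axis i 1) P \<le> (\<kappa> * \<kappa> * ?d) ^ ?d / sqrt L * N
      \<or> escape (axis i 1) P \<le> (\<kappa> * \<kappa> * ?d / sqrt L) ^ ?d * N"
  proof (cases "sqrt L \<le> q")
    case True
    have "escape (axis i 1) P * sqrt L \<le> escape (axis i 1) P * q"
      using True by (intro mult_left_mono) auto
    also have "\<dots> \<le> (\<kappa> * \<kappa> * ?d) ^ ?d * N"
      using esc box_le box_le_N by linarith
    finally have "escape (axis i 1) P \<le> (\<kappa> * \<kappa> * ?d) ^ ?d * N / sqrt L"
      by (simp only: pos_le_divide_eq[OF sL])
    then have "escape (axis i 1) P \<le> (\<kappa> * \<kappa> * ?d) ^ ?d / sqrt L * N"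
      by (simp only: times_divide_eq_left)
    then show ?thesis by blast
  next
    case False
    have "escape (axis i 1) P * 1 \<le> escape (axis i 1) P * q"
      using q1 by (intro mult_left_mono) auto
    then have "escape (axis i 1) P \<le> (\<kappa> * q) ^ ?d"
      using esc box_le by linarith
    also have "\<dots> \<le> (\<kappa> * sqrt L) ^ ?d"
      using False \<kappa> q1 by (intro power_mono mult_left_mono) auto
    also have "\<dots> = (\<kappa> / sqrt L) ^ ?d * L ^ ?d"
    proof -
      have "\<kappa> * sqrt L = \<kappa> / sqrt L * L"
        using real_div_sqrt[of L] \<open>L > 0\<close>
        by (metis less_imp_le times_divide_eq_left times_divide_eq_right)
      then show ?thesis by (simp only: power_mult_distrib)
    qed
    also have "\<dots> \<le> (\<kappa> / sqrt L) ^ ?d * ((?d * \<kappa>) ^ ?d * N)"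
      using N(2) \<kappa> sL by (intro mult_left_mono) auto
    also have "\<dots> = (\<kappa> * \<kappa> * ?d / sqrt L) ^ ?d * N"
      by (simp add: power_mult_distrib power_divide mult_ac)
    finally show ?thesis by blast
  qed
  moreover have "0 \<le> (\<kappa> * \<kappa> * ?d) ^ ?d / sqrt L * N" "0 \<le> (\<kappa> * \<kappa> * ?d / sqrt L) ^ ?d * N"
    using \<kappa> sL N0 by auto
  ultimately have "escape (axis i 1) P
      \<le> (\<kappa> * \<kappa> * ?d) ^ ?d / sqrt L * N + (\<kappa> * \<kappa> * ?d / sqrt L) ^ ?d * N"
    by linarith
  then show ?thesis
    by (simp only: m(2) escape_translate distrib_right)
qed

text \<open>For r at scale \<open>k = q + 2\<close>, the summands belong to blocks 1 to
  \<open>q\<close> (all points counted as lost), the complete block \<open>q + 1\<close>, and the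
  cut piece of block \<open>q + 2\<close>.\<close>

definition escape_bound :: "nat \<Rightarrow> real" where
  "escape_bound q = (2 * (CARD('d) * \<kappa>) * ((\<Sum>j=1..q. l j) / l (q + 1))) ^ CARD('d)
    + CARD('d) * \<kappa> / l (q + 1)
    + ((\<kappa> * \<kappa> * CARD('d)) ^ CARD('d) / sqrt (l (q + 1)) + (\<kappa> * \<kappa> * CARD('d) / sqrt (l (q + 1))) ^ CARD('d))"

lemma escape_bound_tendsto_0: "escape_bound \<longlonglongrightarrow> 0"
proof -
  have l1: "filterlim (\<lambda>q. l (q + 1)) at_top sequentially"
    using l_at_top filterlim_sequentially_Suc[of l] by simp
  have s1: "filterlim (\<lambda>q. sqrt (l (q + 1))) at_top sequentially"
    by (rule filterlim_compose[OF sqrt_at_top l1])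
  have "escape_bound \<longlonglongrightarrow> (2 * (CARD('d) * \<kappa>) * 0) ^ CARD('d) + 0 + (0 + 0 ^ CARD('d))"
    unfolding escape_bound_def
    by (intro tendsto_intros lacunary tendsto_divide_0[OF tendsto_const]
        filterlim_at_top_imp_at_infinity l1 s1)
  then show ?thesis by (simp add: zero_power)
qed

lemma escape_average_set:
  assumes r: "corner (q + 2) \<le> r" "r < corner (Suc (q + 2))"
  shows "escape (axis i 1) (S \<inter> lattice_ball r) \<le> escape_bound q * card (S \<inter> lattice_ball r)"
proof -
  let ?d = "CARD('d)" and ?k = "q + 2" and ?N = "real (card (S \<inter> lattice_ball r))" and ?L = "l (q + 1)"
  have L: "1 \<le> ?L" by (rule one_le_l) simp
  have N: "real (card (block (q + 1))) \<le> ?N" "real (card (block ?k \<inter> lattice_ball r)) \<le> ?N"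
    using average_set_card_ge[of ?k r] r by auto
  have "(1 * ?L) ^ ?d \<le> (1 * (?d * \<kappa>)) ^ ?d * card (block (q + 1))"
    by (rule power_le_card_block) auto
  also have "\<dots> \<le> (?d * \<kappa>) ^ ?d * ?N"
    using N(1) \<kappa> by (simp add: mult_left_mono)
  finally have L_le: "?L ^ ?d \<le> (?d * \<kappa>) ^ ?d * ?N" by simp
  have set_eq: "S \<inter> lattice_ball r = ((\<Union>j\<in>{1..q}. block j) \<union> block (q + 1)) \<union> (block ?k \<inter> lattice_ball r)"
  proof -
    have "{1..<?k} = insert (q + 1) {1..q}" by auto
    then show ?thesis using S_Int_ball[of ?k r] r by auto
  qed
  let ?e = "escape (axis i 1) :: (int ^ 'd) set \<Rightarrow> real"
  have "?e (S \<inter> lattice_ball r) \<le> ?e ((\<Union>j\<in>{1..q}. block j) \<union> block (q + 1)) + ?e (block ?k \<inter> lattice_ball r)"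
    unfolding set_eq by (rule escape_Un_le) auto
  also have "?e ((\<Union>j\<in>{1..q}. block j) \<union> block (q + 1)) \<le> ?e (\<Union>j\<in>{1..q}. block j) + ?e (block (q + 1))"
    by (rule escape_Un_le) auto
  finally have total: "?e (S \<inter> lattice_ball r) \<le> ?e (\<Union>j\<in>{1..q}. block j) + ?e (block (q + 1))
      + ?e (block ?k \<inter> lattice_ball r)" by simp
  have "?e (\<Union>j\<in>{1..q}. block j) \<le> (\<Sum>j\<in>{1..q}. ?e (block j))"
    by (rule escape_UN_le) auto
  also have "\<dots> \<le> (\<Sum>j\<in>{1..q}. (2 * l j) ^ ?d)"
  proof (rule sum_mono)
    fix j assume j: "j \<in> {1..q}"
    have "?e (block j) \<le> card {0..b j}"
      using escape_le_card[OF finite_block, of "axis i 1" j] by (simp only: card_block)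
    also have "\<dots> \<le> (2 * l j) ^ ?d"
    proof (rule card_interval_le_power)
      show "0 \<le> b j" using j by (simp add: b_nonneg)
      show "real_of_int (b j $ i) + 1 \<le> 2 * l j" for i
        using side_le_l[of j i] one_le_l[of j] j by simp
    qed
    finally show "?e (block j) \<le> (2 * l j) ^ ?d" .
  qed
  also have "\<dots> \<le> (\<Sum>j\<in>{1..q}. 2 * l j) ^ ?d"
    using one_le_l by (intro sum_power_le_power_sum) (auto intro: order_trans[OF zero_le_one])
  also have "\<dots> = (2 * ((\<Sum>j=1..q. l j) / ?L)) ^ ?d * ?L ^ ?d"
    using L by (simp add: power_mult_distrib[symmetric] sum_distrib_left)
  also have "\<dots> \<le> (2 * ((\<Sum>j=1..q. l j) / ?L)) ^ ?d * ((?d * \<kappa>) ^ ?d * ?N)"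
    using L_le L one_le_l
    by (intro mult_left_mono zero_le_power mult_nonneg_nonneg divide_nonneg_nonneg sum_nonneg)
      (auto intro: order_trans[OF zero_le_one])
  also have "\<dots> = (2 * (?d * \<kappa>) * ((\<Sum>j=1..q. l j) / ?L)) ^ ?d * ?N"
    by (simp only: power_mult_distrib mult_ac)
  finally have e1: "?e (\<Union>j\<in>{1..q}. block j) \<le> (2 * (?d * \<kappa>) * ((\<Sum>j=1..q. l j) / ?L)) ^ ?d * ?N" .
  have e2: "?e (block (q + 1)) \<le> ?d * \<kappa> / ?L * ?N"
  proof -
    have "?e {0..b (q + 1)} * (real_of_int (b (q + 1) $ i) + 1) \<le> card {0..b (q + 1)}"
      by (rule escape_downset) (auto intro: b_nonneg order_trans)
    then have le: "?e (block (q + 1)) * (real_of_int (b (q + 1) $ i) + 1) \<le> ?N"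
      using N(1) unfolding card_block by (simp add: escape_translate prism_eq_interval)
    have "?e (block (q + 1)) * ?L \<le> ?e (block (q + 1)) * ((?d * \<kappa>) * (real_of_int (b (q + 1) $ i) + 1))"
      using l_le_side[of "q + 1" i] dim_\<kappa>_ge_1 by (intro mult_left_mono) (auto simp: distrib_left)
    also have "\<dots> = (?d * \<kappa>) * (?e (block (q + 1)) * (real_of_int (b (q + 1) $ i) + 1))"
      by simp
    also have "\<dots> \<le> (?d * \<kappa>) * ?N"
      using le dim_\<kappa>_ge_1 by (intro mult_left_mono) auto
    finally show ?thesis using L by (simp add: field_simps)
  qed
  have e3: "?e (block ?k \<inter> lattice_ball r)
    \<le> ((\<kappa> * \<kappa> * ?d) ^ ?d / sqrt ?L + (\<kappa> * \<kappa> * ?d / sqrt ?L) ^ ?d) * ?N"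
    using L r N(2) L_le by (intro escape_last_piece) auto
  show ?thesis
    unfolding escape_bound_def distrib_right[of _ _ ?N] using total e1 e2 e3[unfolded distrib_right] by linarith
qed

lemma average_set_nonempty: "\<forall>\<^sub>F r in at_top. S \<inter> lattice_ball r \<noteq> {}"
  using eventually_scale[of 2]
proof eventually_elim
  case (elim r)
  then obtain k where k: "2 \<le> k" "corner k \<le> r" "r < corner (Suc k)" by blast
  have "diag (a (k - 1)) \<in> block (k - 1)"
    using b_nonneg[of "k - 1"] k(1) by (auto simp: prism_eq_interval image_iff)
  then have "card (block (k - 1)) > 0" by (auto simp: card_gt_0_iff)
  then show ?case using average_set_card_ge(1)[OF k] by auto
qed

lemma asymptotically_invariant_average_sets:
  "asymptotically_invariant (\<lambda>r. S \<inter> lattice_ball r)"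
proof (rule asymptotically_invariantI)
  fix i :: 'd
  show "((\<lambda>r. escape (axis i 1) (S \<inter> lattice_ball r) / card (S \<inter> lattice_ball r)) \<longlongrightarrow> 0) at_top"
  proof (rule tendstoI)
    fix \<epsilon> :: real assume "\<epsilon> > 0"
    then obtain Q where Q: "\<And>q. q \<ge> Q \<Longrightarrow> escape_bound q < \<epsilon>"
      using order_tendstoD(2)[OF escape_bound_tendsto_0] by (auto simp: eventually_sequentially)
    show "\<forall>\<^sub>F r in at_top. dist (escape (axis i 1) (S \<inter> lattice_ball r) / card (S \<inter> lattice_ball r)) 0 < \<epsilon>"
      using eventually_scale[of "Q + 2"] average_set_nonempty
    proof eventually_elim
      case (elim r)
      then obtain k where k: "Q + 2 \<le> k" "corner k \<le> r" "r < corner (Suc k)" by blast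
      have k2: "k - 2 + 2 = k" using k(1) by simp
      have pos: "0 < real (card (S \<inter> lattice_ball r))"
        using elim(2) by (simp add: card_gt_0_iff)
      have "escape (axis i 1) (S \<inter> lattice_ball r) \<le> escape_bound (k - 2) * card (S \<inter> lattice_ball r)"
        using escape_average_set[of "k - 2" r i] k(2,3) unfolding k2 by blast
      then have "escape (axis i 1) (S \<inter> lattice_ball r) / card (S \<inter> lattice_ball r) \<le> escape_bound (k - 2)"
        using pos by (simp add: divide_le_eq)
      also have "\<dots> < \<epsilon>" using k(1) by (intro Q) simp
      finally show ?case by (simp add: dist_real_def)
    qed
  qed
qed simp

end

section \<open>Convergence of the averages\<close>

lemma sum_UN_le_sum_sum:
  fixes h :: "'b \<Rightarrow> real"
  assumes "finite I" "\<And>i. i \<in> I \<Longrightarrow> finite (A i)" "\<And>x. 0 \<le> h x"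
  shows "sum h (\<Union>i\<in>I. A i) \<le> (\<Sum>i\<in>I. sum h (A i))"
  using assms(1,2)
proof (induction I)
  case (insert i I)
  have "sum h (\<Union>j\<in>insert i I. A j) \<le> sum h (A i) + sum h (\<Union>j\<in>I. A j)"
    using insert.prems insert.hyps(1) sum.union_inter[of "A i" "\<Union>j\<in>I. A j" h]
      sum_nonneg[of "A i \<inter> (\<Union>j\<in>I. A j)" h] assms(3) by simp
  then show ?case using insert by fastforce
qed simp

context measure_preserving_action
begin

text \<open>Off the exceedance set each covering cube carries at most
  \<open>u * D * card (F r)\<close>, and there are at most \<open>m\<close> of them. Dividing by
  \<open>m + 1\<close> in \<open>u\<close> stays meaningful for \<open>m = 0\<close>.\<close>

lemma maximal_inequality_averages:
  fixes D :: real
  assumes cone: "cone_condition Fam A" "A \<ge> 0" and "D > 0"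
    and cover: "\<forall>\<^sub>F r in at_top. \<exists>G\<subseteq>Fam. finite G \<and> card G \<le> m \<and>
      F r \<subseteq> (\<Union>(z, s)\<in>G. (+) z ` cube s) \<and>
      (\<forall>(z, s)\<in>G. (real s + 1) ^ CARD('d) \<le> D * card (F r))"
    and e: "integrable M e" and "t > 0"
  shows "\<exists>V\<in>sets M. t * prob V \<le> (real m + 1) * D * A * (\<integral>x. norm (e x) \<partial>M) \<and>
    (\<forall>x\<in>space M - V. \<forall>\<^sub>F r in at_top. norm (set_average T (F r) e x) \<le> t)"
proof (intro bexI conjI ballI)
  define u where "u = t / ((real m + 1) * D)"
  have "u > 0" using \<open>t > 0\<close> \<open>D > 0\<close> by (simp add: u_def)
  let ?V = "exceedance Fam e u"
  show "?V \<in> sets M" using e by (intro exceedance_sets) auto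
  have "u * prob ?V \<le> A * (\<integral>x. norm (e x) \<partial>M)"
    by (rule weak_type[OF cone \<open>u > 0\<close> e])
  then have "(real m + 1) * D * (u * prob ?V) \<le> (real m + 1) * D * (A * (\<integral>x. norm (e x) \<partial>M))"
    using \<open>D > 0\<close> by (intro mult_left_mono) auto
  then show "t * prob ?V \<le> (real m + 1) * D * A * (\<integral>x. norm (e x) \<partial>M)"
    using \<open>D > 0\<close> by (simp add: u_def mult.assoc)
  fix x assume x: "x \<in> space M - ?V"
  show "\<forall>\<^sub>F r in at_top. norm (set_average T (F r) e x) \<le> t"
    using cover
  proof eventually_elim
    case (elim r)
    then obtain G where G: "G \<subseteq> Fam" "finite G" "card G \<le> m"
      "F r \<subseteq> (\<Union>(z, s)\<in>G. (+) z ` cube s)"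
      "\<forall>(z, s)\<in>G. (real s + 1) ^ CARD('d) \<le> D * card (F r)"
      by blast
    let ?h = "\<lambda>n. norm (e (T n x))" and ?N = "real (card (F r))"
    have "norm (\<Sum>n\<in>F r. e (T n x)) \<le> sum ?h (F r)"
      by (rule norm_sum)
    also have "\<dots> \<le> sum ?h (\<Union>(z, s)\<in>G. (+) z ` cube s)"
      using G(2,4) by (intro sum_mono2) auto
    also have "\<dots> \<le> (\<Sum>(z, s)\<in>G. sum ?h ((+) z ` cube s))"
      using sum_UN_le_sum_sum[OF G(2), of "\<lambda>(z, s). (+) z ` cube s" ?h] by (simp add: case_prod_beta)
    also have "\<dots> \<le> (\<Sum>(z, s)\<in>G. u * (D * ?N))"
    proof (rule sum_mono, clarify)
      fix z s assume zs: "(z, s) \<in> G"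
      have "sum ?h ((+) z ` cube s) \<le> u * (real s + 1) ^ CARD('d)"
        using x zs G(1) by (force simp: exceedance_def not_less)
      also have "\<dots> \<le> u * (D * ?N)"
        using G(5) zs \<open>u > 0\<close> by (intro mult_left_mono) auto
      finally show "sum ?h ((+) z ` cube s) \<le> u * (D * ?N)" .
    qed
    also have "\<dots> = real (card G) * (u * (D * ?N))"
      by (simp add: case_prod_beta)
    also have "\<dots> \<le> (real m + 1) * (u * (D * ?N))"
      using G(3) \<open>u > 0\<close> \<open>D > 0\<close> by (intro mult_right_mono) auto
    also have "\<dots> = t * ?N"
      using \<open>D > 0\<close> by (simp add: u_def)
    finally show ?case
      using \<open>t > 0\<close> by (cases "?N = 0") (auto simp: set_average_def norm_divide divide_le_eq)
  qed
qed

lemma bounded_functions_dense: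
  fixes f :: "'a \<Rightarrow> complex"
  assumes f: "integrable M f" and "\<delta> > 0"
  obtains g B where "g \<in> borel_measurable M" "\<And>x. norm (g x) \<le> B"
    "(\<integral>x. norm (f x - g x) \<partial>M) \<le> \<delta>"
proof -
  define g where "g n x = (if norm (f x) \<le> real n then f x else 0)" for n :: nat and x
  have [measurable]: "f \<in> borel_measurable M" using f by auto
  have g_meas: "g n \<in> borel_measurable M" for n
    unfolding g_def by measurable
  have "(\<lambda>n. \<integral>x. norm (f x - g n x) \<partial>M) \<longlonglongrightarrow> (\<integral>x. 0 \<partial>M)"
  proof (rule integral_dominated_convergence[where w = "\<lambda>x. norm (f x)"])
    show "AE x in M. (\<lambda>n. norm (f x - g n x)) \<longlonglongrightarrow> 0"
    proof (rule AE_I2)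
      fix x
      obtain N :: nat where "norm (f x) \<le> real N" using real_arch_simple by blast
      then have "\<forall>n\<ge>N. norm (f x - g n x) = 0" by (auto simp: g_def)
      then show "(\<lambda>n. norm (f x - g n x)) \<longlonglongrightarrow> 0"
        by (intro tendsto_eventually) (auto simp: eventually_sequentially)
    qed
  qed (use f g_meas in \<open>auto simp: g_def\<close>)
  then obtain n where "(\<integral>x. norm (f x - g n x) \<partial>M) < \<delta>"
    using order_tendstoD(2)[of _ "\<integral>x. 0 \<partial>M" sequentially \<delta>] \<open>\<delta> > 0\<close>
      eventually_happens'[OF sequentially_bot] by fastforce
  moreover have "norm (g n x) \<le> real n" for x by (simp add: g_def)
  ultimately show thesis using that[OF g_meas] by (meson less_imp_le)
qed

text \<open>The Banach principle is used twice: from invariant functions plus coboundaries to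
  bounded functions, then from bounded functions to L^1.\<close>

lemma pointwise_L1_goodI:
  fixes F :: "real \<Rightarrow> (int ^ 'd) set" and D :: real
  assumes cone: "cone_condition Fam A" "A \<ge> 0" and "D > 0"
    and cover: "\<forall>\<^sub>F r in at_top. \<exists>G\<subseteq>Fam. finite G \<and> card G \<le> m \<and>
      F r \<subseteq> (\<Union>(z, s)\<in>G. (+) z ` cube s) \<and>
      (\<forall>(z, s)\<in>G. (real s + 1) ^ CARD('d) \<le> D * card (F r))"
    and F: "asymptotically_invariant F" "\<forall>\<^sub>F r in at_top. F r \<noteq> {}"
  shows "pointwise_L1_good M T F"
  unfolding pointwise_L1_good_def
proof (intro allI impI)
  fix f :: "'a \<Rightarrow> complex" assume f: "integrable M f"
  note maximal = maximal_inequality_averages[OF cone \<open>D > 0\<close> cover]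
  have A': "0 \<le> (real m + 1) * D * A" using cone(2) \<open>D > 0\<close> by simp
  show "AE x in M. \<exists>L. ((\<lambda>r. set_average T (F r) f x) \<longlongrightarrow> L) at_top"
  proof (rule AE_convergent_of_approximation[OF maximal A' f])
    fix \<delta> :: real assume "\<delta> > 0"
    obtain g B where g: "g \<in> borel_measurable M" "\<And>x. norm (g x) \<le> B"
      "(\<integral>x. norm (f x - g x) \<partial>M) \<le> \<delta>"
      using bounded_functions_dense[OF f \<open>\<delta> > 0\<close>] by blast
    have g_int: "integrable M g" by (rule integrable_bounded[OF g(1,2)])
    have "AE x in M. \<exists>L. ((\<lambda>r. set_average T (F r) g x) \<longlongrightarrow> L) at_top"
      by (rule AE_convergent_of_approximation[OF maximal A' g_int])
        (auto intro!: bounded_approximation[OF g(1,2) F])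
    then show "\<exists>g. integrable M g \<and> (\<integral>x. norm (f x - g x) \<partial>M) \<le> \<delta> \<and>
        (AE x in M. \<exists>L. ((\<lambda>r. set_average T (F r) g x) \<longlongrightarrow> L) at_top)"
      using g(3) g_int by blast
  qed
qed

end

theorem proposition2p9:
  fixes b :: "nat \<Rightarrow> int ^ 'd::finite"
    and a :: "nat \<Rightarrow> int"
    and l :: "nat \<Rightarrow> real"
    and c C C' :: real
    and S :: "(int ^ 'd) set"
    and M :: "'a measure"
    and T :: "int ^ 'd \<Rightarrow> 'a \<Rightarrow> 'a"
  defines "l \<equiv> \<lambda>k. prism_diameter (b k)"
    and "S \<equiv> (\<Union>k\<in>{1..}. (+) (diag (a k)) ` prism (b k))"
  assumes b_pos: "\<And>k i. k \<ge> 1 \<Longrightarrow> b k $ i > 0"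
    and "c > 0" and "C' > 0"
    and comparable: "\<And>k i j. k \<ge> 1 \<Longrightarrow>
      c \<le> real_of_int (b k $ i) / real_of_int (b k $ j) \<and>
      real_of_int (b k $ i) / real_of_int (b k $ j) \<le> C'"
    and lacunary: "(\<lambda>k. (\<Sum>i=1..k. l i) / l (k + 1)) \<longlonglongrightarrow> 0"
    and a_nonneg: "\<And>k. k \<ge> 1 \<Longrightarrow> a k \<ge> 0"
    and separated: "\<And>k. k \<ge> 1 \<Longrightarrow>
      norm (real_vec (diag (a (k + 1)) :: int ^ 'd)) > norm (real_vec (diag (a k) :: int ^ 'd)) + l k"
    and "C > 0"
    and large: "\<And>k. k \<ge> 2 \<Longrightarrow> l k \<ge> C * norm (real_vec (diag (a (k - 1)) :: int ^ 'd))"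
    and action: "measure_preserving_action M T"
    and aperiodic: "aperiodic M T"
  shows "pointwise_L1_good M T (\<lambda>r. S \<inter> lattice_ball r)"
proof -
  interpret measure_preserving_action M T by (rule action)
  interpret P: sparse_prisms b a "max 1 C'" C
  proof
    fix k i j assume k: "(1::nat) \<le> k"
    have "real_of_int (b k $ i) \<le> C' * real_of_int (b k $ j)"
      using comparable[OF k, of i j] b_pos[OF k, of j] by (simp add: divide_le_eq)
    also have "\<dots> \<le> max 1 C' * real_of_int (b k $ j)"
      using b_pos[OF k, of j] by (intro mult_right_mono) auto
    finally show "real_of_int (b k $ i) \<le> max 1 C' * real_of_int (b k $ j)" .
  qed (use b_pos lacunary a_nonneg separated \<open>C > 0\<close> large in \<open>auto simp: l_def\<close>)
  have S_eq: "S = P.S"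
    by (simp add: S_def P.S_def)
  obtain A where A: "A \<ge> 0" "cone_condition P.family A"
    using P.cone_condition_family by blast
  obtain D :: real where D: "D > 0" "\<forall>\<^sub>F r in at_top. \<exists>G\<subseteq>P.family. finite G \<and> card G \<le> 3 \<and>
      P.S \<inter> lattice_ball r \<subseteq> (\<Union>(z, s)\<in>G. (+) z ` cube s) \<and>
      (\<forall>(z, s)\<in>G. (real s + 1) ^ CARD('d) \<le> D * card (P.S \<inter> lattice_ball r))"
    using P.average_set_covered by blast
  show ?thesis
    unfolding S_eq
    by (rule pointwise_L1_goodI[OF A(2,1) D(1) D(2) P.asymptotically_invariant_average_sets
          P.average_set_nonempty])
qed

end
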